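(* Let $R$ be a commutative Noetherian semiprime ring and let $A=\sigma(R)\langle x_1,\dots,x_n\rangle$ be a bijective skew $PBW$ extension of $R$, with associated system $(\Sigma,\Delta)$ of automorphisms $\Sigma=\{\sigma_1,\dots,\sigma_n\}$ and $\Sigma$-derivations $\Delta=\{\delta_1,\dots,\delta_n\}$ of $R$. Let $I$ be a semiprime $(\Sigma,\Delta)$-invariant ideal of $R$. Then $I$ is a $(\Sigma,\Delta)$-prime ideal of $R$ if and only if $IA$ is a prime ideal of $A$. In such case, $IA=AI$ and $I=IA\cap R$.
   Context: Rings are associative with unit; "ideal" means two-sided ideal. Skew $PBW$ extension: let $R\subseteq A$ be rings. $A$ is a skew $PBW$ extension of $R$, written $A=\sigma(R)\langle x_1,\dots,x_n\rangle$, if there are finitely many elements $x_1,\dots,x_n\in A$ such that: (1) $A$ is a free left $R$-module with basis $\{x^{\alpha}=x_1^{\alpha_1}\cdots x_n^{\alpha_n}\mid \alpha\in\mathbb{N}^n\}$ (with $x_1^0\cdots x_n^0=1$); (2) for every $1\le i\le n$ and $r\in R\setminus\{0\}$ there is $c_{i,r}\in R\setminus\{0\}$ with $x_ir-c_{i,r}x_i\in R$; (3) for all $1\le i,j\le n$ there is $c_{i,j}\in R\setminus\{0\}$ with $x_jx_i-c_{i,j}x_ix_j\in R+Rx_1+\cdots+Rx_n$. For such $A$ there are, for each $i$, an injective ring endomorphism $\sigma_i:R\to R$ and a $\sigma_i$-derivation $\delta_i:R\to R$ (additive, $\delta_i(rs)=\sigma_i(r)\delta_i(s)+\delta_i(r)s$)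 with $x_ir=\sigma_i(r)x_i+\delta_i(r)$ for all $r\in R$. $A$ is bijective if every $\sigma_i$ is bijective and $c_{i,j}$ is invertible for all $1\le i<j\le n$. An ideal $I$ of $R$ is $(\Sigma,\Delta)$-invariant if $\sigma_i(I)\subseteq I$ and $\delta_i(I)\subseteq I$ for every $i$. A proper $(\Sigma,\Delta)$-invariant ideal $I$ of $R$ is $(\Sigma,\Delta)$-prime if whenever a product of two $(\Sigma,\Delta)$-invariant ideals of $R$ is contained in $I$, one of these ideals is contained in $I$. *)

theory Defs
  imports "HOL-Algebra.Algebra"
begin

section \<open>Prime and semiprime two-sided ideals\<close>

text \<open>The library locale \<open>primeideal\<close> presupposes a commutative ring and is phrased elementwise.
  The notions below are the usual ones for two-sided ideals of an arbitrary ring.\<close>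

definition prime_two_sided_ideal :: "'a set \<Rightarrow> ('a, 'm) ring_scheme \<Rightarrow> bool" where
  "prime_two_sided_ideal P S \<longleftrightarrow>
     ideal P S \<and> P \<noteq> carrier S \<and>
     (\<forall>J K. ideal J S \<longrightarrow> ideal K S \<longrightarrow> J \<cdot>\<^bsub>S\<^esub> K \<subseteq> P \<longrightarrow> J \<subseteq> P \<or> K \<subseteq> P)"

text \<open>Semiprime ideals are not required to be proper.\<close>

definition semiprime_ideal :: "'a set \<Rightarrow> ('a, 'm) ring_scheme \<Rightarrow> bool" where
  "semiprime_ideal P S \<longleftrightarrow>
     ideal P S \<and> (\<forall>J. ideal J S \<longrightarrow> J \<cdot>\<^bsub>S\<^esub> J \<subseteq> P \<longrightarrow> J \<subseteq> P)"

definition semiprime_ring :: "('a, 'm) ring_scheme \<Rightarrow> bool" where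
  "semiprime_ring S \<longleftrightarrow> ring S \<and> semiprime_ideal {\<zero>\<^bsub>S\<^esub>} S"


section \<open>Skew PBW extensions\<close>

text \<open>The variables \<open>x\<^sub>1, \<dots>, x\<^sub>n\<close> are indexed from \<open>0\<close>, as \<open>x i\<close> for \<open>i < n\<close>.
  A multi-index is a function on \<open>{..<n}\<close>, extended by \<open>undefined\<close> so that distinct functions
  are distinct multi-indices.\<close>

definition multi_indices :: "nat \<Rightarrow> (nat \<Rightarrow> nat) set" where
  "multi_indices n = {..<n} \<rightarrow>\<^sub>E UNIV"

definition pbw_monomial ::
  "('a, 'm) ring_scheme \<Rightarrow> nat \<Rightarrow> (nat \<Rightarrow> 'a) \<Rightarrow> (nat \<Rightarrow> nat) \<Rightarrow> 'a" where
  "pbw_monomial A n x \<alpha> =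
     foldr (\<otimes>\<^bsub>A\<^esub>) (map (\<lambda>i. x i [^]\<^bsub>A\<^esub> \<alpha> i) [0..<n]) \<one>\<^bsub>A\<^esub>"

text \<open>\<open>R + R x\<^sub>1 + \<cdots> + R x\<^sub>n\<close>\<close>

definition linear_forms ::
  "('a, 'm) ring_scheme \<Rightarrow> 'a set \<Rightarrow> nat \<Rightarrow> (nat \<Rightarrow> 'a) \<Rightarrow> 'a set" where
  "linear_forms A R n x =
     {r \<oplus>\<^bsub>A\<^esub> (\<Oplus>\<^bsub>A\<^esub>i\<in>{..<n}. s i \<otimes>\<^bsub>A\<^esub> x i) | r s. r \<in> R \<and> s \<in> {..<n} \<rightarrow> R}"

text \<open>The library's \<open>module\<close> locale needs a commutative ring of scalars, so freeness of \<open>A\<close> as a left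
  \<open>R\<close>-module is spelled out. As always for PBW bases, the basis is the family
  \<open>(x\<^sup>\<alpha>)\<close> indexed by the multi-indices, so that \<open>x\<^sup>\<alpha>\<close> and \<open>x\<^sup>\<beta>\<close> cannot be
  identified for \<open>\<alpha> \<noteq> \<beta>\<close> (unless \<open>R\<close> is the zero ring).\<close>

locale skew_PBW_extension = ring A for A (structure) +
  fixes R :: "'a set" and n :: nat and x :: "nat \<Rightarrow> 'a"
  assumes subring_R: "subring R A"
    and x_closed: "\<And>i. i < n \<Longrightarrow> x i \<in> carrier A"
    and monomials_span:
      "\<And>a. a \<in> carrier A \<Longrightarrow>
         \<exists>S f. finite S \<and> S \<subseteq> multi_indices n \<and> f \<in> S \<rightarrow> R \<and>
               a = (\<Oplus>\<alpha>\<in>S. f \<alpha> \<otimes> pbw_monomial A n x \<alpha>)"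
    and monomials_independent:
      "\<And>S f. finite S \<Longrightarrow> S \<subseteq> multi_indices n \<Longrightarrow> f \<in> S \<rightarrow> R \<Longrightarrow>
         (\<Oplus>\<alpha>\<in>S. f \<alpha> \<otimes> pbw_monomial A n x \<alpha>) = \<zero> \<Longrightarrow> \<forall>\<alpha>\<in>S. f \<alpha> = \<zero>"
    and x_scalar:
      "\<And>i r. i < n \<Longrightarrow> r \<in> R - {\<zero>} \<Longrightarrow> \<exists>c\<in>R - {\<zero>}. x i \<otimes> r \<ominus> c \<otimes> x i \<in> R"
    and x_x:
      "\<And>i j. i < n \<Longrightarrow> j < n \<Longrightarrow>
         \<exists>c\<in>R - {\<zero>}. x j \<otimes> x i \<ominus> c \<otimes> (x i \<otimes> x j) \<in> linear_forms A R n x"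

definition skew_derivation ::
  "('a, 'm) ring_scheme \<Rightarrow> ('a \<Rightarrow> 'a) \<Rightarrow> ('a \<Rightarrow> 'a) \<Rightarrow> bool" where
  "skew_derivation S \<sigma> \<delta> \<longleftrightarrow>
     \<delta> \<in> carrier S \<rightarrow> carrier S \<and>
     (\<forall>r\<in>carrier S. \<forall>s\<in>carrier S. \<delta> (r \<oplus>\<^bsub>S\<^esub> s) = \<delta> r \<oplus>\<^bsub>S\<^esub> \<delta> s) \<and>
     (\<forall>r\<in>carrier S. \<forall>s\<in>carrier S.
        \<delta> (r \<otimes>\<^bsub>S\<^esub> s) = \<sigma> r \<otimes>\<^bsub>S\<^esub> \<delta> s \<oplus>\<^bsub>S\<^esub> \<delta> r \<otimes>\<^bsub>S\<^esub> s)"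

text \<open>The locale fixes the data attached to a skew PBW extension. Every extension has such data:
  \<open>\<sigma> i\<close> and \<open>\<delta> i\<close> are determined on \<open>R\<close>, and \<open>c i j\<close> is determined for \<open>i < j\<close>, by the freeness
  of \<open>A\<close>.\<close>

locale skew_PBW_system = skew_PBW_extension A R n x for A (structure) and R and n and x +
  fixes \<sigma> \<delta> :: "nat \<Rightarrow> 'a \<Rightarrow> 'a" and c :: "nat \<Rightarrow> nat \<Rightarrow> 'a"
  assumes sigma_hom: "\<And>i. i < n \<Longrightarrow> \<sigma> i \<in> ring_hom (A\<lparr>carrier := R\<rparr>) (A\<lparr>carrier := R\<rparr>)"
    and sigma_inj: "\<And>i. i < n \<Longrightarrow> inj_on (\<sigma> i) R"
    and delta_derivation: "\<And>i. i < n \<Longrightarrow> skew_derivation (A\<lparr>carrier := R\<rparr>) (\<sigma> i) (\<delta> i)"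
    and x_commute: "\<And>i r. i < n \<Longrightarrow> r \<in> R \<Longrightarrow> x i \<otimes> r = \<sigma> i r \<otimes> x i \<oplus> \<delta> i r"
    and c_nonzero: "\<And>i j. i < n \<Longrightarrow> j < n \<Longrightarrow> c i j \<in> R - {\<zero>}"
    and c_relation: "\<And>i j. i < n \<Longrightarrow> j < n \<Longrightarrow>
         x j \<otimes> x i \<ominus> c i j \<otimes> (x i \<otimes> x j) \<in> linear_forms A R n x"

locale bijective_skew_PBW_system = skew_PBW_system +
  assumes sigma_bij: "\<And>i. i < n \<Longrightarrow> bij_betw (\<sigma> i) R R"
    and c_unit: "\<And>i j. i < j \<Longrightarrow> j < n \<Longrightarrow> c i j \<in> Units (A\<lparr>carrier := R\<rparr>)"


section \<open>Invariant and \<open>(\<Sigma>, \<Delta>)\<close>-prime ideals\<close>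

definition invariant_ideal ::
  "('a, 'm) ring_scheme \<Rightarrow> nat \<Rightarrow> (nat \<Rightarrow> 'a \<Rightarrow> 'a) \<Rightarrow> (nat \<Rightarrow> 'a \<Rightarrow> 'a) \<Rightarrow> 'a set \<Rightarrow> bool" where
  "invariant_ideal S n \<sigma> \<delta> I \<longleftrightarrow>
     ideal I S \<and> (\<forall>i<n. \<sigma> i ` I \<subseteq> I \<and> \<delta> i ` I \<subseteq> I)"

definition invariant_prime_ideal ::
  "('a, 'm) ring_scheme \<Rightarrow> nat \<Rightarrow> (nat \<Rightarrow> 'a \<Rightarrow> 'a) \<Rightarrow> (nat \<Rightarrow> 'a \<Rightarrow> 'a) \<Rightarrow> 'a set \<Rightarrow> bool" where
  "invariant_prime_ideal S n \<sigma> \<delta> I \<longleftrightarrow>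
     invariant_ideal S n \<sigma> \<delta> I \<and> I \<noteq> carrier S \<and>
     (\<forall>J K. invariant_ideal S n \<sigma> \<delta> J \<longrightarrow> invariant_ideal S n \<sigma> \<delta> K \<longrightarrow>
            J \<cdot>\<^bsub>S\<^esub> K \<subseteq> I \<longrightarrow> J \<subseteq> I \<or> K \<subseteq> I)"

end

theory Submission
  imports Defs
begin

text \<open>Order the monomials \<open>x\<^sup>\<alpha>\<close> by degree and then lexicographically. Modulo the elements with
  coefficients in \<open>I\<close>, which form the ideal \<open>IA\<close>, the leading coefficient of \<open>f w g\<close>, for a word \<open>w\<close>
  in the variables, is \<open>a \<sigma>\<^sup>\<alpha>(\<sigma>\<^sup>w(b))\<close> up to a unit of \<open>R\<close>, where \<open>a\<close>, \<open>b\<close> are the leading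
  coefficients of \<open>f\<close>, \<open>g\<close> and \<open>\<alpha>\<close> is the leading exponent of \<open>f\<close>. If \<open>f A g \<subseteq> IA\<close>, the \<open>s \<in> R\<close> with
  \<open>a \<sigma>\<^sup>\<alpha>(\<sigma>\<^sup>w(s)) \<in> I\<close> for all \<open>w\<close> form an ideal \<open>K\<close> with \<open>\<sigma>\<^sub>i(K) \<subseteq> K\<close>, hence \<open>\<sigma>\<^sub>i(K) = K\<close> as \<open>R\<close> is
  Noetherian, and so \<open>aK \<subseteq> I\<close>. Since \<open>I\<close> is semiprime, the colon ideals \<open>L = (I : K) \<ni> a\<close> and
  \<open>(I : L) \<ni> b\<close> are invariant not only under \<open>\<Sigma>\<close> but also under \<open>\<Delta>\<close>. Their product lies in \<open>I\<close>, so
  one of \<open>a\<close>, \<open>b\<close> lies in \<open>I\<close>.\<close>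

section \<open>Degree-lexicographic order on multi-indices\<close>

definition mi_degree :: "nat \<Rightarrow> (nat \<Rightarrow> nat) \<Rightarrow> nat" where
  "mi_degree n \<alpha> = (\<Sum>i<n. \<alpha> i)"

text \<open>\<open>restrict\<close> keeps the default \<open>undefined\<close> outside
  \<open>{..<n}\<close>, as the extensional function space \<open>multi_indices n\<close>
  demands.\<close>

definition mi_zero :: "nat \<Rightarrow> nat \<Rightarrow> nat" where
  "mi_zero n = restrict (\<lambda>i. 0) {..<n}"

definition mi_add :: "nat \<Rightarrow> (nat \<Rightarrow> nat) \<Rightarrow> (nat \<Rightarrow> nat) \<Rightarrow> nat \<Rightarrow> nat" where
  "mi_add n \<alpha> \<beta> = restrict (\<lambda>i. \<alpha> i + \<beta> i) {..<n}"

text \<open>The leading exponent of \<open>x i\<close> times the monomial with exponent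
  \<alpha>.\<close>

definition bump :: "nat \<Rightarrow> (nat \<Rightarrow> nat) \<Rightarrow> nat \<Rightarrow> nat" where
  "bump i \<alpha> = \<alpha>(i := Suc (\<alpha> i))"

text \<open>Comparing degrees first makes derivation terms and the linear remainders of the
  relations small. Ties go to the first differing index, so \<open>x 0\<close> is the largest
  variable.\<close>

definition deglex :: "nat \<Rightarrow> (nat \<Rightarrow> nat) \<Rightarrow> (nat \<Rightarrow> nat) \<Rightarrow> bool" where
  "deglex n \<alpha> \<beta> \<longleftrightarrow> mi_degree n \<alpha> < mi_degree n \<beta> \<or>
     mi_degree n \<alpha> = mi_degree n \<beta> \<and> (\<exists>k<n. \<alpha> k < \<beta> k \<and> (\<forall>j<k. \<alpha> j = \<beta> j))"

lemma mi_zero_closed [simp]: "mi_zero n \<in> multi_indices n"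
  by (auto simp: mi_zero_def multi_indices_def)

lemma mi_add_closed [simp]: "mi_add n \<alpha> \<beta> \<in> multi_indices n"
  by (auto simp: mi_add_def multi_indices_def)

lemma bump_closed [simp]: "\<alpha> \<in> multi_indices n \<Longrightarrow> i < n \<Longrightarrow> bump i \<alpha> \<in> multi_indices n"
  by (auto simp: bump_def multi_indices_def PiE_iff extensional_def)

lemma mi_eqI:
  assumes "\<alpha> \<in> multi_indices n" "\<beta> \<in> multi_indices n" "\<And>i. i < n \<Longrightarrow> \<alpha> i = \<beta> i"
  shows "\<alpha> = \<beta>"
  using assms unfolding multi_indices_def by (intro PiE_ext) auto

lemma mi_add_zero: "\<beta> \<in> multi_indices n \<Longrightarrow> mi_add n (mi_zero n) \<beta> = \<beta>"
  by (rule mi_eqI[OF mi_add_closed]) (auto simp: mi_add_def mi_zero_def)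

lemma mi_add_bump: "i < n \<Longrightarrow> mi_add n (bump i \<alpha>) \<beta> = bump i (mi_add n \<alpha> \<beta>)"
  by (auto simp: mi_add_def bump_def fun_eq_iff)

lemma bump_commute: "bump i (bump j \<alpha>) = bump j (bump i \<alpha>)"
  by (auto simp: bump_def fun_eq_iff)

lemma mi_degree_add: "mi_degree n (mi_add n \<alpha> \<beta>) = mi_degree n \<alpha> + mi_degree n \<beta>"
  by (simp add: mi_degree_def mi_add_def sum.distrib)

lemma mi_degree_bump:
  assumes "i < n" shows "mi_degree n (bump i \<alpha>) = Suc (mi_degree n \<alpha>)"
proof -
  have "bump i \<alpha> = (\<lambda>k. \<alpha> k + (if k = i then 1 else 0))"
    by (auto simp: bump_def)
  with assms show ?thesis
    by (simp add: mi_degree_def sum.distrib)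
qed

section \<open>Deglex as a well-founded total order compatible with addition\<close>

lemma deglex_irrefl: "\<not> deglex n \<alpha> \<alpha>"
  by (auto simp: deglex_def)

lemma deglex_trans:
  assumes "deglex n \<alpha> \<beta>" "deglex n \<beta> \<gamma>" shows "deglex n \<alpha> \<gamma>"
proof (cases "mi_degree n \<alpha> = mi_degree n \<beta> \<and> mi_degree n \<beta> = mi_degree n \<gamma>")
  case True
  then obtain k l where k: "k < n" "\<alpha> k < \<beta> k" "\<forall>j<k. \<alpha> j = \<beta> j"
    and l: "l < n" "\<beta> l < \<gamma> l" "\<forall>j<l. \<beta> j = \<gamma> j"
    using assms by (auto simp: deglex_def)
  \<comment> \<open>The smaller of the two deciding indices decides between \<alpha> and
    \<gamma>.\<close>
  have "\<alpha> (min k l) < \<gamma> (min k l)"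
    using k l by (metis min.commute min_def nat_less_le order_less_trans not_less)
  moreover have "\<forall>j<min k l. \<alpha> j = \<gamma> j" "min k l < n" using k l by auto
  ultimately show ?thesis using True unfolding deglex_def by auto
next
  case False
  then show ?thesis using assms by (auto simp: deglex_def)
qed

lemma deglex_total:
  assumes "\<alpha> \<in> multi_indices n" "\<beta> \<in> multi_indices n" "\<alpha> \<noteq> \<beta>"
  shows "deglex n \<alpha> \<beta> \<or> deglex n \<beta> \<alpha>"
proof -
  define k where "k = (LEAST k. k < n \<and> \<alpha> k \<noteq> \<beta> k)"
  have "\<exists>k. k < n \<and> \<alpha> k \<noteq> \<beta> k" using assms mi_eqI by blast
  then have k: "k < n" "\<alpha> k \<noteq> \<beta> k" unfolding k_def by (metis (mono_tags, lifting) LeastI_ex)+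
  have "\<forall>j<k. \<alpha> j = \<beta> j"
    using k(1) not_less_Least unfolding k_def by (metis (mono_tags, lifting) order_less_trans)
  with k show ?thesis unfolding deglex_def by (metis linorder_neqE_nat)
qed

lemma deglex_bump_mono: "i < n \<Longrightarrow> deglex n \<alpha> \<beta> \<Longrightarrow> deglex n (bump i \<alpha>) (bump i \<beta>)"
  unfolding deglex_def by (simp add: mi_degree_bump) (auto simp: bump_def)

lemma deglex_add_mono: "deglex n \<alpha> \<beta> \<Longrightarrow> deglex n (mi_add n \<alpha> \<gamma>) (mi_add n \<beta> \<gamma>)"
  unfolding deglex_def by (simp add: mi_degree_add) (auto simp: mi_add_def)

lemma deglex_degree: "mi_degree n \<alpha> < mi_degree n \<beta> \<Longrightarrow> deglex n \<alpha> \<beta>"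
  by (simp add: deglex_def)

text \<open>In \<open>x_lead_mono_x\<close> this puts every exponent below
  \<open>bump i \<beta>\<close> also below \<open>bump j \<beta>\<close>, within reach of the
  induction hypothesis.\<close>

lemma deglex_bump_less:
  assumes "j < i" "i < n" shows "deglex n (bump i \<alpha>) (bump j \<alpha>)"
proof -
  have "bump i \<alpha> j < bump j \<alpha> j \<and> (\<forall>k<j. bump i \<alpha> k = bump j \<alpha> k)"
    using assms by (auto simp: bump_def)
  moreover have "mi_degree n (bump i \<alpha>) = mi_degree n (bump j \<alpha>)" "j < n"
    using assms by (simp_all add: mi_degree_bump)
  ultimately show ?thesis unfolding deglex_def by blast
qed

text \<open>Each entry is bounded by the degree, so all these exponents lie in a finite box.\<close>

lemma finite_deglex_below: "finite {\<gamma> \<in> multi_indices n. deglex n \<gamma> \<alpha>}"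
proof (rule finite_subset)
  show "{\<gamma> \<in> multi_indices n. deglex n \<gamma> \<alpha>} \<subseteq> {..<n} \<rightarrow>\<^sub>E {..mi_degree n \<alpha>}"
  proof
    fix \<gamma> assume g: "\<gamma> \<in> {\<gamma> \<in> multi_indices n. deglex n \<gamma> \<alpha>}"
    then have "mi_degree n \<gamma> \<le> mi_degree n \<alpha>" by (auto simp: deglex_def)
    moreover have "\<gamma> i \<le> mi_degree n \<gamma>" if "i < n" for i
      unfolding mi_degree_def using that by (intro member_le_sum) auto
    ultimately show "\<gamma> \<in> {..<n} \<rightarrow>\<^sub>E {..mi_degree n \<alpha>}"
      using g by (auto simp: multi_indices_def PiE_iff intro: order_trans)
  qed
qed (simp add: finite_PiE)

text \<open>Well-foundedness is reduced to induction on the number of smaller multi-indices, a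
  finite number by \<open>finite_deglex_below\<close>.\<close>

lemma deglex_induct [consumes 1, case_names less]:
  assumes "\<alpha> \<in> multi_indices n"
    and "\<And>\<alpha>. \<alpha> \<in> multi_indices n \<Longrightarrow>
           (\<And>\<beta>. \<beta> \<in> multi_indices n \<Longrightarrow> deglex n \<beta> \<alpha> \<Longrightarrow> P \<beta>) \<Longrightarrow> P \<alpha>"
  shows "P \<alpha>"
  using assms(1)
proof (induction "card {\<gamma> \<in> multi_indices n. deglex n \<gamma> \<alpha>}" arbitrary: \<alpha> rule: less_induct)
  case less
  show ?case
  proof (rule assms(2)[OF less.prems])
    fix \<beta> assume b: "\<beta> \<in> multi_indices n" "deglex n \<beta> \<alpha>"
    have "{\<gamma> \<in> multi_indices n. deglex n \<gamma> \<beta>} \<subset> {\<gamma> \<in> multi_indices n. deglex n \<gamma> \<alpha>}"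
      using b deglex_trans deglex_irrefl by blast
    then show "P \<beta>" by (intro less.hyps b(1) psubset_card_mono finite_deglex_below)
  qed
qed

lemma finite_deglex_maximal:
  assumes "finite S" "S \<noteq> {}" "S \<subseteq> multi_indices n"
  obtains \<alpha> where "\<alpha> \<in> S" "\<And>\<beta>. \<beta> \<in> S \<Longrightarrow> \<beta> \<noteq> \<alpha> \<Longrightarrow> deglex n \<beta> \<alpha>"
proof -
  have "\<exists>\<alpha>\<in>S. \<forall>\<beta>\<in>S. \<beta> \<noteq> \<alpha> \<longrightarrow> deglex n \<beta> \<alpha>"
    using assms
  proof (induction rule: finite_ne_induct)
    case (insert \<gamma> S)
    then obtain \<alpha> where "\<alpha> \<in> S" "\<forall>\<beta>\<in>S. \<beta> \<noteq> \<alpha> \<longrightarrow> deglex n \<beta> \<alpha>" by auto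
    moreover have "deglex n \<gamma> \<alpha> \<or> deglex n \<alpha> \<gamma>"
      using insert calculation by (intro deglex_total) auto
    ultimately show ?case by (metis deglex_trans insert_iff)
  qed simp
  then show thesis using that by blast
qed

text \<open>Splitting at the first nonzero entry allows \<open>x i\<close> to be peeled off a
  monomial without any reordering, see \<open>mono_x_bump\<close>.\<close>

lemma multi_index_cases:
  assumes "\<alpha> \<in> multi_indices n"
  obtains "\<alpha> = mi_zero n"
  | i \<beta> where "i < n" "\<beta> \<in> multi_indices n" "\<forall>k<i. \<beta> k = 0" "\<alpha> = bump i \<beta>"
proof (cases "\<forall>i<n. \<alpha> i = 0")
  case True
  then have "\<alpha> = mi_zero n" by (intro mi_eqI[OF assms mi_zero_closed]) (auto simp: mi_zero_def)
  then show thesis using that by blast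
next
  case False
  define i where "i = (LEAST k. k < n \<and> \<alpha> k \<noteq> 0)"
  have i: "i < n" "\<alpha> i \<noteq> 0" using False unfolding i_def by (metis (mono_tags, lifting) LeastI_ex)+
  have z: "\<forall>k<i. \<alpha> k = 0"
    using i(1) not_less_Least unfolding i_def by (metis (mono_tags, lifting) order_less_trans)
  define \<beta> where "\<beta> = \<alpha>(i := \<alpha> i - 1)"
  have "\<beta> \<in> multi_indices n"
    using assms i by (auto simp: \<beta>_def multi_indices_def PiE_iff extensional_def)
  moreover have "\<alpha> = bump i \<beta>" using i by (auto simp: \<beta>_def bump_def)
  moreover have "\<forall>k<i. \<beta> k = 0" using z by (simp add: \<beta>_def)
  ultimately show thesis using that i by blast
qed

lemma multi_index_induct [consumes 1, case_names zero bump]: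
  assumes "\<alpha> \<in> multi_indices n"
    and "P (mi_zero n)"
    and "\<And>i \<beta>. i < n \<Longrightarrow> \<beta> \<in> multi_indices n \<Longrightarrow> \<forall>k<i. \<beta> k = 0 \<Longrightarrow> P \<beta> \<Longrightarrow> P (bump i \<beta>)"
  shows "P \<alpha>"
  using assms(1)
proof (induction "mi_degree n \<alpha>" arbitrary: \<alpha> rule: less_induct)
  case less
  from less.prems show ?case
  proof (cases rule: multi_index_cases)
    case (2 i \<beta>)
    then show ?thesis using less.hyps[of \<beta>] assms(3) by (simp add: mi_degree_bump)
  qed (simp add: assms(2))
qed


section \<open>Coefficients with respect to the PBW basis\<close>

context skew_PBW_extension
begin

abbreviation "MI \<equiv> multi_indices n"
abbreviation "mono_x \<equiv> pbw_monomial A n x"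

lemma R_sub: "r \<in> R \<Longrightarrow> r \<in> carrier A"
  using subringE(1)[OF subring_R] by blast

lemma R_simps [simp]:
  "\<zero> \<in> R" "\<one> \<in> R"
  "r \<in> R \<Longrightarrow> \<ominus> r \<in> R"
  "r \<in> R \<Longrightarrow> s \<in> R \<Longrightarrow> r \<otimes> s \<in> R"
  "r \<in> R \<Longrightarrow> s \<in> R \<Longrightarrow> r \<oplus> s \<in> R"
  using subringE[OF subring_R] by auto

lemma pbw_segment_closed:
  "set is \<subseteq> {..<n} \<Longrightarrow> foldr (\<otimes>) (map (\<lambda>i. x i [^] (\<alpha> i :: nat)) is) \<one> \<in> carrier A"
  by (induction "is") (auto simp: x_closed)

lemma mono_x_closed [simp]: "mono_x \<alpha> \<in> carrier A"
  unfolding pbw_monomial_def by (rule pbw_segment_closed) auto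

lemma mono_x_zero: "mono_x (mi_zero n) = \<one>"
proof -
  have "foldr (\<otimes>) (map (\<lambda>i. x i [^] mi_zero n i) is) \<one> = \<one>" if "set is \<subseteq> {..<n}" for "is"
    using that by (induction "is") (auto simp: mi_zero_def)
  from this[of "[0..<n]"] show ?thesis unfolding pbw_monomial_def by (auto simp: atLeast0LessThan)
qed

text \<open>The factors before position i are all \<one>, so the new factor \<open>x i\<close>
  already stands in front.\<close>

lemma mono_x_bump:
  assumes "i < n" "\<forall>k<i. \<alpha> k = 0"
  shows "mono_x (bump i \<alpha>) = x i \<otimes> mono_x \<alpha>"
proof -
  let ?P = "\<lambda>\<alpha> is. foldr (\<otimes>) (map (\<lambda>i. x i [^] (\<alpha> i :: nat)) is) \<one>"
  \<comment> \<open>The claim for the segment starting at k is proved downwards from k = i to k = 0,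
    by induction on i - k.\<close>
  have *: "?P (bump i \<alpha>) [k..<n] = x i \<otimes> ?P \<alpha> [k..<n]" if "k \<le> i" for k
    using that
  proof (induction "i - k" arbitrary: k)
    case 0
    then have k: "k = i" by simp
    have "?P (bump i \<alpha>) [Suc i..<n] = ?P \<alpha> [Suc i..<n]"
      by (rule arg_cong[where f = "\<lambda>l. foldr (\<otimes>) l \<one>"]) (auto simp: bump_def)
    moreover have "x i [^] bump i \<alpha> i = x i \<otimes> (x i [^] \<alpha> i)"
      using nat_pow_Suc2[OF x_closed[OF assms(1)]] by (simp add: bump_def)
    moreover have "?P \<alpha> [Suc i..<n] \<in> carrier A" by (rule pbw_segment_closed) auto
    ultimately show ?case
      using assms(1) by (simp add: k upt_conv_Cons m_assoc x_closed)
  next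
    case (Suc m)
    then have "k < i" and m: "m = i - Suc k" "Suc k \<le> i" by auto
    then have "x k [^] bump i \<alpha> k = \<one>" "x k [^] \<alpha> k = \<one>"
      using assms by (simp_all add: bump_def)
    moreover have "?P \<alpha> [Suc k..<n] \<in> carrier A" by (rule pbw_segment_closed) auto
    ultimately show ?case
      using Suc.hyps(1)[OF m] \<open>k < i\<close> assms(1) by (simp add: upt_conv_Cons x_closed)
  qed
  show ?thesis unfolding pbw_monomial_def using *[of 0] by simp
qed


section \<open>Coefficient functions\<close>

definition represents :: "'a \<Rightarrow> ((nat \<Rightarrow> nat) \<Rightarrow> 'a) \<Rightarrow> bool" where
  "represents a f \<longleftrightarrow> f \<in> MI \<rightarrow> R \<and>
     (\<exists>S. finite S \<and> S \<subseteq> MI \<and> (\<forall>\<alpha>\<in>MI - S. f \<alpha> = \<zero>) \<and> a = (\<Oplus>\<alpha>\<in>S. f \<alpha> \<otimes> mono_x \<alpha>))"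

text \<open>Freeness fixes the values on \<open>MI\<close> only; elsewhere \<open>coef a\<close> is
  arbitrary, hence the condition \<alpha> \<in> \<open>MI\<close> in the facts below.\<close>

definition coef :: "'a \<Rightarrow> (nat \<Rightarrow> nat) \<Rightarrow> 'a" where
  "coef a = (SOME f. represents a f)"

lemma term_closed: "f \<in> MI \<rightarrow> R \<Longrightarrow> S \<subseteq> MI \<Longrightarrow> (\<lambda>\<alpha>. f \<alpha> \<otimes> mono_x \<alpha>) \<in> S \<rightarrow> carrier A"
  by (auto intro!: m_closed intro: R_sub)

lemma sum_extend:
  assumes "finite T" "S \<subseteq> T" "T \<subseteq> MI" "f \<in> MI \<rightarrow> R" "\<forall>\<alpha>\<in>MI - S. f \<alpha> = \<zero>"
  shows "(\<Oplus>\<alpha>\<in>S. f \<alpha> \<otimes> mono_x \<alpha>) = (\<Oplus>\<alpha>\<in>T. f \<alpha> \<otimes> mono_x \<alpha>)"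
  using assms by (intro add.finprod_mono_neutral_cong_left) (auto intro!: m_closed intro: R_sub)

lemma represents_common:
  assumes "represents a f" "represents b g"
  obtains T where "finite T" "T \<subseteq> MI" "\<forall>\<alpha>\<in>MI - T. f \<alpha> = \<zero> \<and> g \<alpha> = \<zero>"
    "a = (\<Oplus>\<alpha>\<in>T. f \<alpha> \<otimes> mono_x \<alpha>)" "b = (\<Oplus>\<alpha>\<in>T. g \<alpha> \<otimes> mono_x \<alpha>)"
proof -
  obtain S S' where S: "finite S" "S \<subseteq> MI" "\<forall>\<alpha>\<in>MI - S. f \<alpha> = \<zero>" "a = (\<Oplus>\<alpha>\<in>S. f \<alpha> \<otimes> mono_x \<alpha>)"
    and S': "finite S'" "S' \<subseteq> MI" "\<forall>\<alpha>\<in>MI - S'. g \<alpha> = \<zero>" "b = (\<Oplus>\<alpha>\<in>S'. g \<alpha> \<otimes> mono_x \<alpha>)"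
    and fg: "f \<in> MI \<rightarrow> R" "g \<in> MI \<rightarrow> R"
    using assms unfolding represents_def by auto
  show thesis
  proof (rule that[of "S \<union> S'"])
    show "a = (\<Oplus>\<alpha>\<in>S \<union> S'. f \<alpha> \<otimes> mono_x \<alpha>)"
      unfolding S(4) using S S' fg by (intro sum_extend) auto
    show "b = (\<Oplus>\<alpha>\<in>S \<union> S'. g \<alpha> \<otimes> mono_x \<alpha>)"
      unfolding S'(4) using S S' fg by (intro sum_extend) auto
  qed (use S S' in auto)
qed

lemma represents_unique:
  assumes "represents a f" "represents a g" "\<alpha> \<in> MI"
  shows "f \<alpha> = g \<alpha>"
proof -
  obtain T where T: "finite T" "T \<subseteq> MI" "\<forall>\<alpha>\<in>MI - T. f \<alpha> = \<zero> \<and> g \<alpha> = \<zero>"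
    "a = (\<Oplus>\<alpha>\<in>T. f \<alpha> \<otimes> mono_x \<alpha>)" "a = (\<Oplus>\<alpha>\<in>T. g \<alpha> \<otimes> mono_x \<alpha>)"
    by (rule represents_common[OF assms(1,2)])
  have fg: "f \<in> MI \<rightarrow> R" "g \<in> MI \<rightarrow> R" using assms by (auto simp: represents_def)
  then have fg': "\<And>\<alpha>. \<alpha> \<in> T \<Longrightarrow> f \<alpha> \<in> R" "\<And>\<alpha>. \<alpha> \<in> T \<Longrightarrow> g \<alpha> \<in> R" using T by auto
  have a: "a \<in> carrier A" unfolding T(4) using T(2) fg by (intro finsum_closed term_closed) auto
  \<comment> \<open>The difference is written with the factor \<open>\<ominus> \<one>\<close>, which
    distributivity pulls out of the whole sum; independence is then applied to the differences of
    coefficients.\<close>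
  have "(\<Oplus>\<alpha>\<in>T. (f \<alpha> \<oplus> \<ominus> \<one> \<otimes> g \<alpha>) \<otimes> mono_x \<alpha>) =
        (\<Oplus>\<alpha>\<in>T. f \<alpha> \<otimes> mono_x \<alpha> \<oplus> \<ominus> \<one> \<otimes> (g \<alpha> \<otimes> mono_x \<alpha>))"
    using fg' by (intro finsum_cong') (auto intro!: m_closed simp: l_distr R_sub m_assoc)
  also have "\<dots> = (\<Oplus>\<alpha>\<in>T. f \<alpha> \<otimes> mono_x \<alpha>) \<oplus> (\<Oplus>\<alpha>\<in>T. \<ominus> \<one> \<otimes> (g \<alpha> \<otimes> mono_x \<alpha>))"
    using fg' by (intro finsum_addf) (auto intro!: m_closed simp: R_sub)
  also have "(\<Oplus>\<alpha>\<in>T. \<ominus> \<one> \<otimes> (g \<alpha> \<otimes> mono_x \<alpha>)) = \<ominus> \<one> \<otimes> (\<Oplus>\<alpha>\<in>T. g \<alpha> \<otimes> mono_x \<alpha>)"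
    using fg' T(1) by (intro finsum_rdistr[symmetric]) (auto intro!: m_closed simp: R_sub)
  also have "(\<Oplus>\<alpha>\<in>T. f \<alpha> \<otimes> mono_x \<alpha>) \<oplus> \<ominus> \<one> \<otimes> (\<Oplus>\<alpha>\<in>T. g \<alpha> \<otimes> mono_x \<alpha>) = \<zero>"
    unfolding T(4,5)[symmetric] using a by (simp add: l_minus r_neg)
  finally have "\<forall>\<alpha>\<in>T. f \<alpha> \<oplus> \<ominus> \<one> \<otimes> g \<alpha> = \<zero>"
    using fg' by (intro monomials_independent[OF T(1,2)]) auto
  then have "\<forall>\<alpha>\<in>T. f \<alpha> = g \<alpha>"
    using fg' by (metis R_sub l_minus l_one one_closed add.inv_closed minus_equality minus_minus a_comm)
  then show ?thesis using T(3) assms(3) by (cases "\<alpha> \<in> T") auto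
qed

lemma represents_coef:
  assumes "a \<in> carrier A" shows "represents a (coef a)"
proof -
  obtain S f where S: "finite S" "S \<subseteq> MI" "f \<in> S \<rightarrow> R" "a = (\<Oplus>\<alpha>\<in>S. f \<alpha> \<otimes> mono_x \<alpha>)"
    using monomials_span[OF assms] by blast
  have "\<And>\<alpha>. \<alpha> \<in> S \<Longrightarrow> f \<alpha> \<in> carrier A" using S(3) R_sub by auto
  then have "(\<Oplus>\<alpha>\<in>S. f \<alpha> \<otimes> mono_x \<alpha>) = (\<Oplus>\<alpha>\<in>S. (if \<alpha> \<in> S then f \<alpha> else \<zero>) \<otimes> mono_x \<alpha>)"
    by (intro finsum_cong') auto
  then have "represents a (\<lambda>\<alpha>. if \<alpha> \<in> S then f \<alpha> else \<zero>)"
    unfolding represents_def using S by (auto intro!: exI[of _ S])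
  then show ?thesis unfolding coef_def by (rule someI[where P = "represents a"])
qed

lemma coef_eqI: "represents a f \<Longrightarrow> \<alpha> \<in> MI \<Longrightarrow> coef a \<alpha> = f \<alpha>"
proof -
  assume a: "represents a f" "\<alpha> \<in> MI"
  then have "a \<in> carrier A"
    unfolding represents_def by (metis finsum_closed term_closed)
  with a show ?thesis by (intro represents_unique[OF represents_coef])
qed

lemma coef_closed [simp]: "a \<in> carrier A \<Longrightarrow> \<alpha> \<in> MI \<Longrightarrow> coef a \<alpha> \<in> R"
  using represents_coef[of a] by (auto simp: represents_def)

lemma coef_expansion:
  assumes "a \<in> carrier A"
  obtains S where "finite S" "S \<subseteq> MI" "\<forall>\<alpha>\<in>MI - S. coef a \<alpha> = \<zero>"
    "a = (\<Oplus>\<alpha>\<in>S. coef a \<alpha> \<otimes> mono_x \<alpha>)"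
  using represents_coef[OF assms] that unfolding represents_def by blast

lemma coef_add:
  assumes "a \<in> carrier A" "b \<in> carrier A" "\<alpha> \<in> MI"
  shows "coef (a \<oplus> b) \<alpha> = coef a \<alpha> \<oplus> coef b \<alpha>"
proof (rule coef_eqI[OF _ assms(3)])
  obtain T where T: "finite T" "T \<subseteq> MI" "\<forall>\<alpha>\<in>MI - T. coef a \<alpha> = \<zero> \<and> coef b \<alpha> = \<zero>"
    "a = (\<Oplus>\<alpha>\<in>T. coef a \<alpha> \<otimes> mono_x \<alpha>)" "b = (\<Oplus>\<alpha>\<in>T. coef b \<alpha> \<otimes> mono_x \<alpha>)"
    by (rule represents_common[OF represents_coef[OF assms(1)] represents_coef[OF assms(2)]])
  have c: "\<And>\<alpha>. \<alpha> \<in> T \<Longrightarrow> coef a \<alpha> \<in> R \<and> coef b \<alpha> \<in> R" using T(2) assms by auto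
  have "a \<oplus> b = (\<Oplus>\<alpha>\<in>T. coef a \<alpha> \<otimes> mono_x \<alpha>) \<oplus> (\<Oplus>\<alpha>\<in>T. coef b \<alpha> \<otimes> mono_x \<alpha>)" using T(4,5) by simp
  also have "\<dots> = (\<Oplus>\<alpha>\<in>T. coef a \<alpha> \<otimes> mono_x \<alpha> \<oplus> coef b \<alpha> \<otimes> mono_x \<alpha>)"
    using c by (intro finsum_addf[symmetric]) (auto intro!: m_closed simp: R_sub)
  also have "\<dots> = (\<Oplus>\<alpha>\<in>T. (coef a \<alpha> \<oplus> coef b \<alpha>) \<otimes> mono_x \<alpha>)"
    using c by (intro finsum_cong') (auto intro!: m_closed simp: R_sub l_distr)
  finally show "represents (a \<oplus> b) (\<lambda>\<alpha>. coef a \<alpha> \<oplus> coef b \<alpha>)"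
    unfolding represents_def using T(1-3) assms by (auto intro!: exI[of _ T])
qed

lemma coef_smult:
  assumes "r \<in> R" "a \<in> carrier A" "\<alpha> \<in> MI"
  shows "coef (r \<otimes> a) \<alpha> = r \<otimes> coef a \<alpha>"
proof (rule coef_eqI[OF _ assms(3)])
  obtain T where T: "finite T" "T \<subseteq> MI" "\<forall>\<alpha>\<in>MI - T. coef a \<alpha> = \<zero>"
    "a = (\<Oplus>\<alpha>\<in>T. coef a \<alpha> \<otimes> mono_x \<alpha>)"
    by (rule coef_expansion[OF assms(2)])
  have c: "\<And>\<alpha>. \<alpha> \<in> T \<Longrightarrow> coef a \<alpha> \<in> R" using T(2) assms by auto
  have "r \<otimes> a = r \<otimes> (\<Oplus>\<alpha>\<in>T. coef a \<alpha> \<otimes> mono_x \<alpha>)" using T(4) by simp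
  also have "\<dots> = (\<Oplus>\<alpha>\<in>T. r \<otimes> (coef a \<alpha> \<otimes> mono_x \<alpha>))"
    using c T(1) assms(1) by (intro finsum_rdistr) (auto intro!: m_closed simp: R_sub)
  also have "\<dots> = (\<Oplus>\<alpha>\<in>T. (r \<otimes> coef a \<alpha>) \<otimes> mono_x \<alpha>)"
    using c assms(1) by (intro finsum_cong') (auto intro!: m_closed simp: R_sub m_assoc)
  finally show "represents (r \<otimes> a) (\<lambda>\<alpha>. r \<otimes> coef a \<alpha>)"
    unfolding represents_def using T(1-3) assms by (auto intro!: exI[of _ T] simp: R_sub)
qed

lemma coef_monomial:
  assumes "r \<in> R" "\<alpha> \<in> MI" "\<beta> \<in> MI"
  shows "coef (r \<otimes> mono_x \<alpha>) \<beta> = (if \<beta> = \<alpha> then r else \<zero>)"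
proof (rule coef_eqI[OF _ assms(3)])
  show "represents (r \<otimes> mono_x \<alpha>) (\<lambda>\<beta>. if \<beta> = \<alpha> then r else \<zero>)"
    unfolding represents_def using assms by (auto intro!: exI[of _ "{\<alpha>}"] simp: R_sub)
qed

lemma coef_zero [simp]: "\<alpha> \<in> MI \<Longrightarrow> coef \<zero> \<alpha> = \<zero>"
  using coef_smult[of \<zero> \<zero> \<alpha>] coef_closed[of \<zero> \<alpha>] by (simp add: R_sub)

lemma coef_uminus: "a \<in> carrier A \<Longrightarrow> \<alpha> \<in> MI \<Longrightarrow> coef (\<ominus> a) \<alpha> = \<ominus> coef a \<alpha>"
  using coef_smult[of "\<ominus> \<one>" a \<alpha>] coef_closed[of a \<alpha>] by (simp add: R_sub l_minus)

lemma coef_scalar: "r \<in> R \<Longrightarrow> coef r (mi_zero n) = r"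
  using coef_monomial[of r "mi_zero n" "mi_zero n"] by (simp add: mono_x_zero R_sub)

lemma finsum_in_closed_set:
  assumes "finite S" "f \<in> S \<rightarrow> P" "P \<subseteq> carrier A" "\<zero> \<in> P"
    and "\<And>a b. a \<in> P \<Longrightarrow> b \<in> P \<Longrightarrow> a \<oplus> b \<in> P"
  shows "finsum A f S \<in> P"
  using assms(1,2)
proof (induction rule: finite_induct)
  case (insert s S)
  then have "f \<in> S \<rightarrow> carrier A" "f s \<in> carrier A" using assms(3) by auto
  with insert show ?case using assms(5) by auto
qed (simp add: assms(4))

text \<open>The device for reducing claims about elements to claims about single terms. It is
  applied mostly to sets of those h for which \<open>x i \<otimes> h\<close> or
  \<open>h \<otimes> g\<close> lies in a given additively closed set.\<close>

lemma in_closed_set_if_terms: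
  assumes "a \<in> carrier A" "P \<subseteq> carrier A" "\<zero> \<in> P"
    and "\<And>a b. a \<in> P \<Longrightarrow> b \<in> P \<Longrightarrow> a \<oplus> b \<in> P"
    and "\<And>\<alpha>. \<alpha> \<in> MI \<Longrightarrow> coef a \<alpha> \<otimes> mono_x \<alpha> \<in> P"
  shows "a \<in> P"
proof -
  obtain S where S: "finite S" "S \<subseteq> MI" "\<forall>\<alpha>\<in>MI - S. coef a \<alpha> = \<zero>"
    "a = (\<Oplus>\<alpha>\<in>S. coef a \<alpha> \<otimes> mono_x \<alpha>)"
    by (rule coef_expansion[OF assms(1)])
  show ?thesis
    by (subst S(4), rule finsum_in_closed_set) (use S assms in auto)
qed

end


section \<open>Leading coefficients modulo an invariant ideal\<close>

locale commutative_skew_PBW = bijective_skew_PBW_system +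
  assumes R_cring: "cring (A\<lparr>carrier := R\<rparr>)"
begin

abbreviation "RR \<equiv> A\<lparr>carrier := R\<rparr>"

section \<open>Arithmetic of the commutative coefficient ring, its units and ideals\<close>

lemma R_comm: "r \<in> R \<Longrightarrow> s \<in> R \<Longrightarrow> r \<otimes> s = s \<otimes> r"
  using cring.cring_simprules(14)[OF R_cring, of r s] by simp

lemma sigma_closed [simp]: "i < n \<Longrightarrow> r \<in> R \<Longrightarrow> \<sigma> i r \<in> R"
  using sigma_hom by (auto simp: ring_hom_def)

lemma sigma_simps [simp]:
  assumes "i < n" "r \<in> R" "s \<in> R"
  shows "\<sigma> i (r \<oplus> s) = \<sigma> i r \<oplus> \<sigma> i s" "\<sigma> i (r \<otimes> s) = \<sigma> i r \<otimes> \<sigma> i s"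
  using sigma_hom[OF assms(1)] assms by (auto simp: ring_hom_def)

lemma sigma_one [simp]: "i < n \<Longrightarrow> \<sigma> i \<one> = \<one>"
  using sigma_hom by (auto simp: ring_hom_def)

lemma sigma_zero [simp]: "i < n \<Longrightarrow> \<sigma> i \<zero> = \<zero>"
  using sigma_simps(1)[of i \<zero> \<zero>] sigma_closed[of i \<zero>] R_sub[of "\<sigma> i \<zero>"]
    add.r_cancel_one'[of "\<sigma> i \<zero>" "\<sigma> i \<zero>"] by (simp del: sigma_simps)

lemma delta_closed [simp]: "i < n \<Longrightarrow> r \<in> R \<Longrightarrow> \<delta> i r \<in> R"
  using delta_derivation[of i] by (auto simp: skew_derivation_def)

lemma delta_mult [simp]:
  assumes "i < n" "r \<in> R" "s \<in> R"
  shows "\<delta> i (r \<otimes> s) = \<sigma> i r \<otimes> \<delta> i s \<oplus> \<delta> i r \<otimes> s"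
  using delta_derivation[OF assms(1)] assms by (auto simp: skew_derivation_def)

lemma foldr_sigma_closed [simp]: "set w \<subseteq> {..<n} \<Longrightarrow> r \<in> R \<Longrightarrow> foldr \<sigma> w r \<in> R"
  by (induction w) auto

lemma foldr_sigma_zero [simp]: "set w \<subseteq> {..<n} \<Longrightarrow> foldr \<sigma> w \<zero> = \<zero>"
  by (induction w) auto

lemma foldr_sigma_simps [simp]:
  assumes "set w \<subseteq> {..<n}" "r \<in> R" "s \<in> R"
  shows "foldr \<sigma> w (r \<oplus> s) = foldr \<sigma> w r \<oplus> foldr \<sigma> w s"
    "foldr \<sigma> w (r \<otimes> s) = foldr \<sigma> w r \<otimes> foldr \<sigma> w s"
  using assms by (induction w) auto

lemma R_Units: "u \<in> Units RR \<longleftrightarrow> u \<in> R \<and> (\<exists>v\<in>R. u \<otimes> v = \<one>)"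
  using R_comm by (auto simp: Units_def)

lemma R_Units_closed: "u \<in> Units RR \<Longrightarrow> u \<in> R"
  by (simp add: R_Units)

lemma R_Units_mult: "u \<in> Units RR \<Longrightarrow> v \<in> Units RR \<Longrightarrow> u \<otimes> v \<in> Units RR"
  using monoid.Units_m_closed[OF ring.is_monoid[OF cring.axioms(1)[OF R_cring]], of u v] by simp

lemma R_Units_one: "\<one> \<in> Units RR"
  unfolding R_Units using R_sub by (auto intro!: bexI[of _ \<one>])

lemma sigma_Units: "i < n \<Longrightarrow> u \<in> Units RR \<Longrightarrow> \<sigma> i u \<in> Units RR"
  unfolding R_Units by (metis sigma_closed sigma_simps(2) sigma_one)

lemma foldr_sigma_Units: "set w \<subseteq> {..<n} \<Longrightarrow> u \<in> Units RR \<Longrightarrow> foldr \<sigma> w u \<in> Units RR"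
  by (induction w) (auto intro: sigma_Units)

lemma R_ideal_simps:
  assumes "ideal I RR"
  shows "I \<subseteq> R" "\<zero> \<in> I" "\<And>a b. a \<in> I \<Longrightarrow> b \<in> I \<Longrightarrow> a \<oplus> b \<in> I"
    "\<And>a r. a \<in> I \<Longrightarrow> r \<in> R \<Longrightarrow> r \<otimes> a \<in> I" "\<And>a r. a \<in> I \<Longrightarrow> r \<in> R \<Longrightarrow> a \<otimes> r \<in> I"
    "\<And>a. a \<in> I \<Longrightarrow> \<ominus> a \<in> I"
proof -
  interpret I: ideal I RR by fact
  show sub: "I \<subseteq> R" using I.a_subset by simp
  show "\<zero> \<in> I" "\<And>a b. a \<in> I \<Longrightarrow> b \<in> I \<Longrightarrow> a \<oplus> b \<in> I"
    using additive_subgroup.zero_closed[OF ideal.axioms(1)[OF assms]]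
      additive_subgroup.a_closed[OF ideal.axioms(1)[OF assms]] by auto
  show l: "\<And>a r. a \<in> I \<Longrightarrow> r \<in> R \<Longrightarrow> r \<otimes> a \<in> I"
    and "\<And>a r. a \<in> I \<Longrightarrow> r \<in> R \<Longrightarrow> a \<otimes> r \<in> I"
    using I.I_l_closed I.I_r_closed by auto
  show "\<ominus> a \<in> I" if "a \<in> I" for a
    using l[OF that, of "\<ominus> \<one>"] R_sub[OF subsetD[OF sub that]] by (simp add: l_minus)
qed

lemma R_idealI:
  assumes "I \<subseteq> R" "\<zero> \<in> I" "\<And>a b. a \<in> I \<Longrightarrow> b \<in> I \<Longrightarrow> a \<oplus> b \<in> I"
    and l: "\<And>a r. a \<in> I \<Longrightarrow> r \<in> R \<Longrightarrow> r \<otimes> a \<in> I"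
  shows "ideal I RR"
proof (rule idealI)
  show "ring RR" using R_cring cring.axioms(1) by blast
  interpret S: ring RR by fact
  show "subgroup I (add_monoid RR)"
  proof (rule S.add.subgroupI)
    show "\<ominus>\<^bsub>RR\<^esub> a \<in> I" if "a \<in> I" for a
    proof -
      have "\<ominus> a \<in> I"
        using l[OF that, of "\<ominus> \<one>"] R_sub[OF subsetD[OF assms(1) that]] by (simp add: l_minus)
      moreover have "\<ominus>\<^bsub>RR\<^esub> a = \<ominus> a"
        using assms(1) that R_sub by (intro S.minus_equality) (auto simp: l_neg)
      ultimately show ?thesis by simp
    qed
  qed (use assms in auto)
  show "a \<otimes>\<^bsub>RR\<^esub> r \<in> I" if "a \<in> I" "r \<in> carrier RR" for a r
    using l[of a r] that assms(1) R_comm[of a r] by auto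
qed (use assms in auto)

lemma Units_cancel_ideal:
  assumes "ideal I RR" "r \<in> R" "u \<in> Units RR" "r \<otimes> u \<in> I"
  shows "r \<in> I"
proof -
  obtain v where v: "v \<in> R" "u \<in> R" "u \<otimes> v = \<one>" using assms(3) by (auto simp: R_Units)
  then have "r \<otimes> u \<otimes> v = r" using assms(2) by (simp add: m_assoc R_sub)
  then show ?thesis using R_ideal_simps(5)[OF assms(1,4) v(1)] by simp
qed

lemma x_scalar_mult:
  assumes "i < n" "r \<in> R" "a \<in> carrier A"
  shows "x i \<otimes> (r \<otimes> a) = \<sigma> i r \<otimes> (x i \<otimes> a) \<oplus> \<delta> i r \<otimes> a"
proof -
  have "x i \<otimes> (r \<otimes> a) = (\<sigma> i r \<otimes> x i \<oplus> \<delta> i r) \<otimes> a"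
    using assms by (simp add: m_assoc[symmetric] x_commute x_closed R_sub)
  then show ?thesis using assms by (simp add: l_distr m_assoc x_closed R_sub)
qed

end


locale skew_PBW_invariant_ideal = commutative_skew_PBW +
  fixes I :: "'a set"
  assumes I_invariant: "invariant_ideal (A\<lparr>carrier := R\<rparr>) n \<sigma> \<delta> I"
begin

lemma I_ideal: "ideal I RR"
  using I_invariant by (simp add: invariant_ideal_def)

lemmas I_simps [simp] = R_ideal_simps(2-6)[OF I_ideal]

lemma I_sub: "r \<in> I \<Longrightarrow> r \<in> R"
  using R_ideal_simps(1)[OF I_ideal] by blast

lemma I_stable [simp]: "i < n \<Longrightarrow> r \<in> I \<Longrightarrow> \<sigma> i r \<in> I" "i < n \<Longrightarrow> r \<in> I \<Longrightarrow> \<delta> i r \<in> I"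
  using I_invariant by (auto simp: invariant_ideal_def)

text \<open>This is IA, as \<open>coefs_in_eq_prod\<close> shows; the description by coefficients is
  the one that computations use.\<close>

definition coefs_in :: "'a set" where
  "coefs_in = {a \<in> carrier A. \<forall>\<beta>\<in>MI. coef a \<beta> \<in> I}"

text \<open>Smallness modulo IA: coefficients at exponents not below \<zeta> have to lie in
  \<open>I\<close>, not to vanish.\<close>

definition below :: "(nat \<Rightarrow> nat) \<Rightarrow> 'a set" where
  "below \<zeta> = {a \<in> carrier A. \<forall>\<beta>\<in>MI. \<not> deglex n \<beta> \<zeta> \<longrightarrow> coef a \<beta> \<in> I}"

text \<open>For a multi-index \<zeta>, u is determined only modulo \<open>I\<close>, and it may
  itself lie in \<open>I\<close>. Hence products of leading terms never require a case
  distinction.\<close>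

definition lead :: "(nat \<Rightarrow> nat) \<Rightarrow> 'a \<Rightarrow> 'a \<Rightarrow> bool" where
  "lead \<zeta> a u \<longleftrightarrow> u \<in> R \<and> (\<exists>l\<in>below \<zeta>. a = u \<otimes> mono_x \<zeta> \<oplus> l)"

lemma below_sub: "below \<zeta> \<subseteq> carrier A"
  by (auto simp: below_def)

lemma below_closed: "a \<in> below \<zeta> \<Longrightarrow> a \<in> carrier A"
  by (auto simp: below_def)

lemma below_zero [simp]: "\<zero> \<in> below \<zeta>"
  by (simp add: below_def)

lemma below_add [simp]: "a \<in> below \<zeta> \<Longrightarrow> b \<in> below \<zeta> \<Longrightarrow> a \<oplus> b \<in> below \<zeta>"
  by (simp add: below_def coef_add)

lemma below_smult [simp]: "r \<in> R \<Longrightarrow> a \<in> below \<zeta> \<Longrightarrow> r \<otimes> a \<in> below \<zeta>"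
  by (simp add: below_def coef_smult R_sub)

lemma below_I_mult: "r \<in> I \<Longrightarrow> a \<in> carrier A \<Longrightarrow> r \<otimes> a \<in> below \<zeta>"
  by (simp add: below_def coef_smult I_sub R_sub)

lemma below_mono_x: "\<gamma> \<in> MI \<Longrightarrow> deglex n \<gamma> \<zeta> \<Longrightarrow> mono_x \<gamma> \<in> below \<zeta>"
  using coef_monomial[of \<one> \<gamma>] by (auto simp: below_def)

lemma below_trans: "deglex n \<eta> \<zeta> \<Longrightarrow> a \<in> below \<eta> \<Longrightarrow> a \<in> below \<zeta>"
  using deglex_trans by (auto simp: below_def)

lemma lead_below: "lead \<eta> a u \<Longrightarrow> \<eta> \<in> MI \<Longrightarrow> deglex n \<eta> \<zeta> \<Longrightarrow> a \<in> below \<zeta>"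
  using below_trans below_mono_x by (auto simp: lead_def)

lemma lead_closed: "lead \<eta> a u \<Longrightarrow> a \<in> carrier A" "lead \<eta> a u \<Longrightarrow> u \<in> R"
  using below_closed by (auto simp: lead_def R_sub)

lemma lead_add_below: "lead \<eta> a u \<Longrightarrow> l \<in> below \<eta> \<Longrightarrow> lead \<eta> (a \<oplus> l) u"
  unfolding lead_def by (auto simp: a_assoc below_closed R_sub intro!: bexI[of _ "_ \<oplus> l"])

lemma lead_smult:
  assumes "r \<in> R" "lead \<eta> a u" shows "lead \<eta> (r \<otimes> a) (r \<otimes> u)"
proof -
  obtain l where "l \<in> below \<eta>" "a = u \<otimes> mono_x \<eta> \<oplus> l" "u \<in> R" using assms by (auto simp: lead_def)
  then show ?thesis using assms(1) unfolding lead_def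
    by (auto simp: r_distr m_assoc below_closed R_sub intro!: bexI[of _ "r \<otimes> l"])
qed

text \<open>Expand l and commute \<open>x i\<close> past each coefficient r. Exponents below \<eta>
  are covered by the two hypotheses on monomials. For all others r lies in \<open>I\<close>, and
  then so do \<open>\<sigma> i r\<close> and \<open>\<delta> i r\<close> by invariance.\<close>

lemma x_below:
  assumes "i < n" "l \<in> below \<eta>"
    and "\<And>\<beta>. \<beta> \<in> MI \<Longrightarrow> deglex n \<beta> \<eta> \<Longrightarrow> mono_x \<beta> \<in> below \<zeta>"
    and "\<And>\<beta>. \<beta> \<in> MI \<Longrightarrow> deglex n \<beta> \<eta> \<Longrightarrow> x i \<otimes> mono_x \<beta> \<in> below \<zeta>"
  shows "x i \<otimes> l \<in> below \<zeta>"
proof -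
  have "l \<in> {b \<in> carrier A. x i \<otimes> b \<in> below \<zeta>}"
  proof (rule in_closed_set_if_terms)
    fix \<alpha> assume a: "\<alpha> \<in> MI"
    let ?r = "coef l \<alpha>"
    have l: "l \<in> carrier A" using assms(2) by (rule below_closed)
    then have r: "?r \<in> R" using a by simp
    have "\<sigma> i ?r \<otimes> (x i \<otimes> mono_x \<alpha>) \<oplus> \<delta> i ?r \<otimes> mono_x \<alpha> \<in> below \<zeta>"
    proof (cases "deglex n \<alpha> \<eta>")
      case True
      then show ?thesis using assms a r by simp
    next
      case False
      then have "?r \<in> I" using assms(2) a by (auto simp: below_def)
      then show ?thesis using assms(1) x_closed by (simp add: below_I_mult)
    qed
    then show "?r \<otimes> mono_x \<alpha> \<in> {b \<in> carrier A. x i \<otimes> b \<in> below \<zeta>}"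
      using r assms(1) by (simp add: x_scalar_mult R_sub)
  qed (use assms(1,2) x_closed below_closed in \<open>auto simp: r_distr\<close>)
  then show ?thesis by simp
qed

lemma lead_mono_x: "u \<in> R \<Longrightarrow> lead \<eta> (u \<otimes> mono_x \<eta>) u"
  unfolding lead_def by (auto intro!: bexI[of _ \<zero>] simp: R_sub)

text \<open>Controls the remainder that appears when two variables are interchanged in front of a
  monomial.\<close>

lemma linear_form_mono_x:
  assumes "p \<in> linear_forms A R n x" "mono_x \<alpha> \<in> below \<zeta>"
    and "\<And>k. k < n \<Longrightarrow> x k \<otimes> mono_x \<alpha> \<in> below \<zeta>"
  shows "p \<otimes> mono_x \<alpha> \<in> below \<zeta>"
proof -
  obtain r s where p: "p = r \<oplus> (\<Oplus>i\<in>{..<n}. s i \<otimes> x i)" "r \<in> R" "s \<in> {..<n} \<rightarrow> R"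
    using assms(1) by (auto simp: linear_forms_def)
  have s: "\<And>i. i < n \<Longrightarrow> s i \<in> R" using p(3) by auto
  then have sx: "(\<lambda>i. s i \<otimes> x i) \<in> {..<n} \<rightarrow> carrier A" by (auto simp: R_sub x_closed)
  have "(\<Oplus>i\<in>{..<n}. s i \<otimes> x i) \<otimes> mono_x \<alpha> = (\<Oplus>i\<in>{..<n}. s i \<otimes> x i \<otimes> mono_x \<alpha>)"
    using sx by (intro finsum_ldistr) auto
  moreover have "\<dots> \<in> below \<zeta>"
    using s assms(3) by (intro finsum_in_closed_set) (auto simp: m_assoc R_sub x_closed below_sub)
  ultimately show ?thesis using p(1,2) sx assms(2) by (simp add: l_distr R_sub)
qed

text \<open>If no variable before \<open>x i\<close> occurs, the product is a basis monomial.
  Otherwise the first variable \<open>x j\<close> has j < i; the relation moves \<open>x i\<close>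
  past it at the cost of a unit and a linear remainder, and the induction hypothesis handles
  \<open>x i\<close> times the remaining monomial. All i are treated at once because the remainder
  involves every variable.\<close>

lemma x_lead_mono_x:
  assumes "\<alpha> \<in> MI"
  shows "\<forall>i<n. \<exists>u\<in>Units RR. lead (bump i \<alpha>) (x i \<otimes> mono_x \<alpha>) u"
  using assms
proof (induction rule: deglex_induct)
  case (less \<alpha>)
  show ?case
  proof (intro allI impI)
    fix i assume i: "i < n"
    show "\<exists>u\<in>Units RR. lead (bump i \<alpha>) (x i \<otimes> mono_x \<alpha>) u"
    proof (cases "\<forall>k<i. \<alpha> k = 0")
      case True
      then have "lead (bump i \<alpha>) (x i \<otimes> mono_x \<alpha>) \<one>"
        using lead_mono_x[of \<one> "bump i \<alpha>"] mono_x_bump[OF i True] by (simp add: x_closed i)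
      then show ?thesis using R_Units_one by blast
    next
      case False
      from \<open>\<alpha> \<in> MI\<close> obtain j \<beta> where j: "j < n" "\<beta> \<in> MI" "\<forall>k<j. \<beta> k = 0" "\<alpha> = bump j \<beta>"
        using False i by (cases rule: multi_index_cases) (auto simp: mi_zero_def)
      \<comment> \<open>A nonzero entry of \<alpha> at some m < i forces j \<le> m, since
        \<open>bump j \<beta>\<close> vanishes before j.\<close>
      obtain m where m: "m < i" "bump j \<beta> m \<noteq> 0" using False j(4) by blast
      then have "\<not> m < j" using j(3) by (auto simp: bump_def)
      with m have ji: "j < i" by simp
      let ?\<zeta> = "bump i \<alpha>"
      have \<zeta>: "?\<zeta> = bump j (bump i \<beta>)" by (simp add: j(4) bump_commute)
      have small: "deglex n \<gamma> ?\<zeta>" if "mi_degree n \<gamma> \<le> mi_degree n \<alpha>" for \<gamma>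
        using that i by (intro deglex_degree) (simp add: mi_degree_bump)
      have \<beta>\<alpha>: "deglex n \<beta> \<alpha>" using j by (intro deglex_degree) (simp add: mi_degree_bump)
      have xk: "x k \<otimes> mono_x \<beta> \<in> below ?\<zeta>" if k: "k < n" for k
      proof -
        obtain u where "lead (bump k \<beta>) (x k \<otimes> mono_x \<beta>) u"
          using less.IH[OF j(2) \<beta>\<alpha>] k by blast
        moreover have "mi_degree n (bump k \<beta>) \<le> mi_degree n \<alpha>"
          using k j by (simp add: mi_degree_bump)
        ultimately show ?thesis using lead_below bump_closed[OF j(2) k] small by blast
      qed
      obtain u where u: "u \<in> Units RR" "lead (bump i \<beta>) (x i \<otimes> mono_x \<beta>) u"
        using less.IH[OF j(2) \<beta>\<alpha>] i by blast
      then obtain l where l: "l \<in> below (bump i \<beta>)" "x i \<otimes> mono_x \<beta> = u \<otimes> mono_x (bump i \<beta>) \<oplus> l"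
        "u \<in> R" by (auto simp: lead_def)
      \<comment> \<open>Each \<gamma> below \<open>bump i \<beta>\<close> is below \<alpha>, so the
        induction hypothesis gives the leading exponent \<open>bump j \<gamma>\<close> of
        \<open>x j \<otimes> mono_x \<gamma>\<close>; it is below
        \<open>bump j (bump i \<beta>)\<close> by monotonicity.\<close>
      have xjl: "x j \<otimes> l \<in> below ?\<zeta>"
      proof (rule x_below[OF j(1) l(1)])
        fix \<gamma> assume g: "\<gamma> \<in> MI" "deglex n \<gamma> (bump i \<beta>)"
        have "deglex n \<gamma> \<alpha>" using deglex_trans[OF g(2) deglex_bump_less[OF ji i]] j(4) by simp
        then obtain v where v: "lead (bump j \<gamma>) (x j \<otimes> mono_x \<gamma>) v"
          using less.IH[OF g(1)] j(1) by blast
        show "x j \<otimes> mono_x \<gamma> \<in> below ?\<zeta>"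
          unfolding \<zeta> using v g j(1) by (intro lead_below[OF v] deglex_bump_mono) auto
        show "mono_x \<gamma> \<in> below ?\<zeta>"
          using \<open>deglex n \<gamma> \<alpha>\<close> by (intro below_mono_x g small) (auto simp: deglex_def)
      qed
      \<comment> \<open>Bijectivity makes \<open>c j i\<close> a unit because j < i, and this is the
        constant that occurs when \<open>x i\<close> is moved to the right of
        \<open>x j\<close>.\<close>
      let ?d = "c j i"
      have d: "?d \<in> Units RR" "?d \<in> R" using c_unit[OF ji i] by (auto simp: R_Units)
      define p where "p = x i \<otimes> x j \<ominus> ?d \<otimes> (x j \<otimes> x i)"
      have p: "p \<in> linear_forms A R n x" unfolding p_def by (rule c_relation[OF j(1) i])
      have cl: "x i \<in> carrier A" "x j \<in> carrier A" "?d \<in> carrier A" "p \<in> carrier A" "l \<in> carrier A"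
        using i j d x_closed R_sub below_closed[OF l(1)] by (auto simp: p_def)
      have "x i \<otimes> x j = ?d \<otimes> (x j \<otimes> x i) \<oplus> p"
        unfolding p_def using cl by (simp add: minus_eq a_assoc a_comm a_lcomm l_neg r_neg)
      then have "x i \<otimes> mono_x \<alpha> = (?d \<otimes> (x j \<otimes> x i) \<oplus> p) \<otimes> mono_x \<beta>"
        using mono_x_bump[OF j(1,3)] j(4) cl by (simp add: m_assoc[symmetric])
      also have "\<dots> = ?d \<otimes> (x j \<otimes> (u \<otimes> mono_x (bump i \<beta>) \<oplus> l)) \<oplus> p \<otimes> mono_x \<beta>"
        using cl l(2) by (simp add: l_distr m_assoc)
      \<comment> \<open>The product of \<open>x j\<close> with the monomial of
        \<open>bump i \<beta>\<close> needs no reordering: that exponent vanishes before j because j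
        < i.\<close>
      also have "x j \<otimes> (u \<otimes> mono_x (bump i \<beta>) \<oplus> l) =
          \<sigma> j u \<otimes> mono_x ?\<zeta> \<oplus> (\<delta> j u \<otimes> mono_x (bump i \<beta>) \<oplus> x j \<otimes> l)"
        using cl l(3) j(1,3) ji mono_x_bump[OF j(1), of "bump i \<beta>"]
        by (simp add: r_distr x_scalar_mult R_sub a_assoc \<zeta>) (simp add: bump_def)
      finally have eq: "x i \<otimes> mono_x \<alpha> = ?d \<otimes> (\<sigma> j u \<otimes> mono_x ?\<zeta> \<oplus>
          (\<delta> j u \<otimes> mono_x (bump i \<beta>) \<oplus> x j \<otimes> l)) \<oplus> p \<otimes> mono_x \<beta>" .
      have "mono_x (bump i \<beta>) \<in> below ?\<zeta>"
        using i j by (intro below_mono_x small) (auto simp: mi_degree_bump)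
      moreover have "mono_x \<beta> \<in> below ?\<zeta>"
        using j by (intro below_mono_x small) (auto simp: mi_degree_bump)
      then have "p \<otimes> mono_x \<beta> \<in> below ?\<zeta>" by (rule linear_form_mono_x[OF p _ xk])
      ultimately have "lead ?\<zeta> (x i \<otimes> mono_x \<alpha>) (?d \<otimes> \<sigma> j u)"
        unfolding eq using xjl d l(3) j(1)
        by (intro lead_add_below lead_smult lead_mono_x) auto
      then show ?thesis using R_Units_mult[OF d(1) sigma_Units[OF j(1) u(1)]] by blast
    qed
  qed
qed

text \<open>Commuting \<open>x i\<close> past b twists it by \<open>\<sigma> i\<close>; the
  derivation term stays at \<eta>, which has smaller degree. The unit v comes from reordering the
  variables.\<close>

lemma lead_x:
  assumes "i < n" "\<eta> \<in> MI" "lead \<eta> g b"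
  shows "\<exists>v\<in>Units RR. lead (bump i \<eta>) (x i \<otimes> g) (\<sigma> i b \<otimes> v)"
proof -
  obtain l where l: "l \<in> below \<eta>" "g = b \<otimes> mono_x \<eta> \<oplus> l" "b \<in> R" using assms(3) by (auto simp: lead_def)
  obtain v where v: "v \<in> Units RR" "lead (bump i \<eta>) (x i \<otimes> mono_x \<eta>) v"
    using x_lead_mono_x[OF assms(2)] assms(1) by blast
  have less: "deglex n \<eta> (bump i \<eta>)" using assms(1) by (intro deglex_degree) (simp add: mi_degree_bump)
  have "x i \<otimes> l \<in> below (bump i \<eta>)"
  proof (rule x_below[OF assms(1) l(1)])
    fix \<gamma> assume g: "\<gamma> \<in> MI" "deglex n \<gamma> \<eta>"
    then show "mono_x \<gamma> \<in> below (bump i \<eta>)" by (intro below_mono_x deglex_trans[OF g(2) less])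
    obtain w where "lead (bump i \<gamma>) (x i \<otimes> mono_x \<gamma>) w"
      using x_lead_mono_x[OF g(1)] assms(1) by blast
    then show "x i \<otimes> mono_x \<gamma> \<in> below (bump i \<eta>)"
      using g assms(1) by (elim lead_below) (auto intro: deglex_bump_mono)
  qed
  moreover have "mono_x \<eta> \<in> below (bump i \<eta>)" using assms(2) less by (rule below_mono_x)
  moreover have "x i \<otimes> g = \<sigma> i b \<otimes> (x i \<otimes> mono_x \<eta>) \<oplus> (\<delta> i b \<otimes> mono_x \<eta> \<oplus> x i \<otimes> l)"
    using assms(1) l by (simp add: r_distr x_scalar_mult R_sub x_closed below_closed a_assoc)
  ultimately have "lead (bump i \<eta>) (x i \<otimes> g) (\<sigma> i b \<otimes> v)"
    using assms(1) l(3) v(2) by (simp add: lead_add_below lead_smult)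
  then show ?thesis using v(1) by blast
qed

section \<open>Leading coefficients of words and of products\<close>

lemma lead_sigma_step:
  assumes "i < n" "\<eta> \<in> MI" "set w \<subseteq> {..<n}" "b \<in> R" "v \<in> Units RR"
    and "lead \<eta> g (foldr \<sigma> w b \<otimes> v)"
  shows "\<exists>v\<in>Units RR. lead (bump i \<eta>) (x i \<otimes> g) (foldr \<sigma> (i # w) b \<otimes> v)"
proof -
  obtain v' where v': "v' \<in> Units RR" "lead (bump i \<eta>) (x i \<otimes> g) (\<sigma> i (foldr \<sigma> w b \<otimes> v) \<otimes> v')"
    using lead_x[OF assms(1,2,6)] by blast
  have "\<sigma> i (foldr \<sigma> w b \<otimes> v) \<otimes> v' = foldr \<sigma> (i # w) b \<otimes> (\<sigma> i v \<otimes> v')"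
    using assms(1,3,4,5) v'(1) by (simp add: m_assoc R_sub R_Units_closed)
  then show ?thesis using v' assms(1,5) by (metis R_Units_mult sigma_Units)
qed

text \<open>The exponent can stay existential, since \<open>lead_coef_in_I\<close> reads off the
  coefficient at whichever multi-index it occurs.\<close>

lemma lead_word:
  assumes "set w \<subseteq> {..<n}" "\<eta> \<in> MI" "lead \<eta> g b"
  shows "\<exists>\<zeta>\<in>MI. \<exists>v\<in>Units RR. lead \<zeta> (foldr (\<lambda>i h. x i \<otimes> h) w g) (foldr \<sigma> w b \<otimes> v)"
  using assms(1)
proof (induction w)
  case Nil
  have "b \<otimes> \<one> = b" using assms(3) by (simp add: lead_closed R_sub)
  then show ?case using assms(2,3) R_Units_one
    by (auto intro!: bexI[of _ \<eta>] bexI[of _ \<one>])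
next
  case (Cons i w)
  then obtain \<zeta> v where "\<zeta> \<in> MI" "v \<in> Units RR"
    "lead \<zeta> (foldr (\<lambda>i h. x i \<otimes> h) w g) (foldr \<sigma> w b \<otimes> v)" by auto
  then have "\<exists>v\<in>Units RR. lead (bump i \<zeta>) (x i \<otimes> foldr (\<lambda>i h. x i \<otimes> h) w g) (foldr \<sigma> (i # w) b \<otimes> v)"
    using Cons.prems lead_closed[OF assms(3)] by (intro lead_sigma_step) auto
  then show ?case using \<open>\<zeta> \<in> MI\<close> Cons.prems by (auto intro!: bexI[of _ "bump i \<zeta>"])
qed

text \<open>The order of quantifiers matters: w spells out the variables of the monomial and depends
  on \<alpha> alone, while the unit may depend on g.\<close>

lemma mono_x_mult_lead:
  assumes "\<alpha> \<in> MI"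
  shows "\<exists>w. set w \<subseteq> {..<n} \<and> (\<forall>\<eta>\<in>MI. \<forall>g b. lead \<eta> g b \<longrightarrow>
    (\<exists>v\<in>Units RR. lead (mi_add n \<alpha> \<eta>) (mono_x \<alpha> \<otimes> g) (foldr \<sigma> w b \<otimes> v)))"
  using assms
proof (induction rule: multi_index_induct)
  case zero
  have "lead (mi_add n (mi_zero n) \<eta>) (mono_x (mi_zero n) \<otimes> g) (foldr \<sigma> [] b \<otimes> \<one>)"
    if "\<eta> \<in> MI" "lead \<eta> g b" for \<eta> g b
    using that lead_closed[OF that(2)] by (simp add: mi_add_zero mono_x_zero R_sub)
  then show ?case using R_Units_one by (intro exI[of _ "[]"]) force
next
  case (bump i \<beta>)
  then obtain w where w: "set w \<subseteq> {..<n}" "\<forall>\<eta>\<in>MI. \<forall>g b. lead \<eta> g b \<longrightarrow>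
    (\<exists>v\<in>Units RR. lead (mi_add n \<beta> \<eta>) (mono_x \<beta> \<otimes> g) (foldr \<sigma> w b \<otimes> v))" by blast
  have "\<exists>v\<in>Units RR. lead (mi_add n (bump i \<beta>) \<eta>) (mono_x (bump i \<beta>) \<otimes> g) (foldr \<sigma> (i # w) b \<otimes> v)"
    if e: "\<eta> \<in> MI" "lead \<eta> g b" for \<eta> g b
  proof -
    obtain v where v: "v \<in> Units RR" "lead (mi_add n \<beta> \<eta>) (mono_x \<beta> \<otimes> g) (foldr \<sigma> w b \<otimes> v)"
      using w(2) e by blast
    have "\<exists>v\<in>Units RR. lead (bump i (mi_add n \<beta> \<eta>)) (x i \<otimes> (mono_x \<beta> \<otimes> g)) (foldr \<sigma> (i # w) b \<otimes> v)"
      using bump w(1) v lead_closed[OF e(2)] by (intro lead_sigma_step) auto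
    then show ?thesis
      using bump lead_closed[OF e(2)] by (simp add: mi_add_bump mono_x_bump m_assoc x_closed)
  qed
  then show ?case using bump w(1) by (intro exI[of _ "i # w"]) auto
qed

text \<open>Expand l: a term with exponent \<alpha> below \<zeta> contributes at
  \<open>mi_add n \<alpha> \<eta>\<close>, which is smaller by monotonicity of addition; every other
  term has its coefficient in \<open>I\<close>.\<close>

lemma below_mult_lead:
  assumes "l \<in> below \<zeta>" "\<eta> \<in> MI" "lead \<eta> g b"
  shows "l \<otimes> g \<in> below (mi_add n \<zeta> \<eta>)"
proof -
  have g: "g \<in> carrier A" using lead_closed[OF assms(3)] by simp
  have "l \<in> {h \<in> carrier A. h \<otimes> g \<in> below (mi_add n \<zeta> \<eta>)}"
  proof (rule in_closed_set_if_terms)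
    fix \<alpha> assume a: "\<alpha> \<in> MI"
    have r: "coef l \<alpha> \<in> R" using a assms(1) below_closed by simp
    have "coef l \<alpha> \<otimes> (mono_x \<alpha> \<otimes> g) \<in> below (mi_add n \<zeta> \<eta>)"
    proof (cases "deglex n \<alpha> \<zeta>")
      case True
      obtain w v where "lead (mi_add n \<alpha> \<eta>) (mono_x \<alpha> \<otimes> g) (foldr \<sigma> w b \<otimes> v)"
        using mono_x_mult_lead[OF a] assms(2,3) by blast
      then have "mono_x \<alpha> \<otimes> g \<in> below (mi_add n \<zeta> \<eta>)"
        by (rule lead_below) (auto intro: deglex_add_mono True)
      then show ?thesis using r by simp
    next
      case False
      then have "coef l \<alpha> \<in> I" using assms(1) a by (auto simp: below_def)
      then show ?thesis using g by (simp add: below_I_mult)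
    qed
    then show "coef l \<alpha> \<otimes> mono_x \<alpha> \<in> {h \<in> carrier A. h \<otimes> g \<in> below (mi_add n \<zeta> \<eta>)}"
      using r g by (simp add: m_assoc R_sub)
  qed (use assms(1) g below_closed in \<open>auto simp: l_distr\<close>)
  then show ?thesis by simp
qed

text \<open>Here \<open>foldr \<sigma> w\<close> plays the role of \<sigma> to the power \<zeta>.
  One word serves all right factors g, which makes the ideal K in
  \<open>word_product_notin_coefs_in\<close> definable.\<close>

lemma lead_mult:
  assumes "\<zeta> \<in> MI"
  obtains w where "set w \<subseteq> {..<n}"
    "\<And>f a \<eta> g b. lead \<zeta> f a \<Longrightarrow> \<eta> \<in> MI \<Longrightarrow> lead \<eta> g b \<Longrightarrow>
       \<exists>v\<in>Units RR. lead (mi_add n \<zeta> \<eta>) (f \<otimes> g) (a \<otimes> (foldr \<sigma> w b \<otimes> v))"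
proof -
  obtain w where w: "set w \<subseteq> {..<n}" "\<And>\<eta> g b. \<eta> \<in> MI \<Longrightarrow> lead \<eta> g b \<Longrightarrow>
    \<exists>v\<in>Units RR. lead (mi_add n \<zeta> \<eta>) (mono_x \<zeta> \<otimes> g) (foldr \<sigma> w b \<otimes> v)"
    using mono_x_mult_lead[OF assms] by blast
  show thesis
  proof (rule that[OF w(1)])
    fix f a \<eta> g b assume f: "lead \<zeta> f a" and g: "\<eta> \<in> MI" "lead \<eta> g b"
    obtain v where v: "v \<in> Units RR" "lead (mi_add n \<zeta> \<eta>) (mono_x \<zeta> \<otimes> g) (foldr \<sigma> w b \<otimes> v)"
      using w(2)[OF g] by blast
    obtain l where l: "l \<in> below \<zeta>" "f = a \<otimes> mono_x \<zeta> \<oplus> l" "a \<in> R" using f by (auto simp: lead_def)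
    have "f \<otimes> g = a \<otimes> (mono_x \<zeta> \<otimes> g) \<oplus> l \<otimes> g"
      using l lead_closed(1)[OF g(2)] by (simp add: l_distr m_assoc R_sub below_closed)
    then have "lead (mi_add n \<zeta> \<eta>) (f \<otimes> g) (a \<otimes> (foldr \<sigma> w b \<otimes> v))"
      using v(2) l below_mult_lead[OF l(1) g] by (simp add: lead_add_below lead_smult)
    then show "\<exists>v\<in>Units RR. lead (mi_add n \<zeta> \<eta>) (f \<otimes> g) (a \<otimes> (foldr \<sigma> w b \<otimes> v))"
      using v(1) by blast
  qed
qed

lemma lead_coef_in_I:
  assumes "lead \<zeta> h u" "\<zeta> \<in> MI" "h \<in> coefs_in"
  shows "u \<in> I"
proof -
  obtain l where l: "l \<in> below \<zeta>" "h = u \<otimes> mono_x \<zeta> \<oplus> l" "u \<in> R" using assms(1) by (auto simp: lead_def)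
  have lI: "coef l \<zeta> \<in> I" using l(1) assms(2) deglex_irrefl by (auto simp: below_def)
  have "coef h \<zeta> = u \<oplus> coef l \<zeta>"
    using l assms(2) by (simp add: coef_add coef_monomial R_sub below_closed)
  then have "u \<oplus> coef l \<zeta> \<in> I" using assms by (auto simp: coefs_in_def)
  then have "u \<oplus> coef l \<zeta> \<oplus> \<ominus> coef l \<zeta> \<in> I" using lI by simp
  then show ?thesis using l(3) lI by (simp add: a_assoc R_sub I_sub r_neg)
qed

lemma lead_exists:
  assumes "f \<in> carrier A" "f \<notin> coefs_in"
  obtains \<zeta> u where "\<zeta> \<in> MI" "u \<in> R" "u \<notin> I" "lead \<zeta> f u"
proof -
  \<comment> \<open>The leading exponent modulo IA is the largest one whose coefficient is outside
    \<open>I\<close>; there are finitely many of these because zero coefficients lie in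
    \<open>I\<close>.\<close>
  let ?T = "{\<alpha> \<in> MI. coef f \<alpha> \<notin> I}"
  obtain S where S: "finite S" "S \<subseteq> MI" "\<forall>\<alpha>\<in>MI - S. coef f \<alpha> = \<zero>" "f = (\<Oplus>\<alpha>\<in>S. coef f \<alpha> \<otimes> mono_x \<alpha>)"
    by (rule coef_expansion[OF assms(1)])
  have "coef f \<alpha> \<in> I" if "\<alpha> \<in> MI" "\<alpha> \<notin> S" for \<alpha>
    using S(3) that by simp
  then have "?T \<subseteq> S" by blast
  then have "finite ?T" using S(1) finite_subset by blast
  moreover have "?T \<noteq> {}" using assms by (auto simp: coefs_in_def)
  ultimately obtain \<zeta> where z: "\<zeta> \<in> ?T" "\<And>\<beta>. \<beta> \<in> ?T \<Longrightarrow> \<beta> \<noteq> \<zeta> \<Longrightarrow> deglex n \<beta> \<zeta>"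
    by (rule finite_deglex_maximal) auto
  let ?u = "coef f \<zeta>"
  have u: "?u \<in> R" using z assms by simp
  let ?l = "f \<oplus> \<ominus> (?u \<otimes> mono_x \<zeta>)"
  have "coef ?l \<beta> \<in> I" if b: "\<beta> \<in> MI" "\<not> deglex n \<beta> \<zeta>" for \<beta>
  proof (cases "\<beta> = \<zeta>")
    case True
    then show ?thesis using u b assms(1)
      by (simp add: coef_add coef_uminus coef_monomial R_sub r_neg)
  next
    case False
    then have "coef f \<beta> \<in> I" using z(2) b by blast
    then show ?thesis using u b z(1) assms(1) False
      by (simp add: coef_add coef_uminus coef_monomial R_sub I_sub)
  qed
  then have "?l \<in> below \<zeta>" using assms(1) u by (simp add: below_def R_sub)
  moreover have "f = ?u \<otimes> mono_x \<zeta> \<oplus> ?l"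
    using assms(1) u by (simp add: a_lcomm R_sub r_neg)
  ultimately have "lead \<zeta> f ?u" using u unfolding lead_def by blast
  then show thesis using that z(1) u by blast
qed

end


section \<open>The ideal \<open>IA\<close>\<close>

context commutative_skew_PBW
begin

section \<open>Colon ideals, semiprimeness and the Noetherian condition\<close>

definition colon :: "'a set \<Rightarrow> 'a set \<Rightarrow> 'a set" where
  "colon I K = {r \<in> R. \<forall>k\<in>K. r \<otimes> k \<in> I}"

lemma colon_ideal:
  assumes "ideal I RR" "K \<subseteq> R" shows "ideal (colon I K) RR"
proof (rule R_idealI)
  have K: "\<And>k. k \<in> K \<Longrightarrow> k \<in> R" using assms(2) by auto
  show "\<zero> \<in> colon I K" using R_ideal_simps(2)[OF assms(1)] K by (simp add: colon_def R_sub)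
  show "a \<oplus> b \<in> colon I K" if "a \<in> colon I K" "b \<in> colon I K" for a b
    using that R_ideal_simps(3)[OF assms(1)] K by (simp add: colon_def R_sub l_distr)
  show "r \<otimes> a \<in> colon I K" if "a \<in> colon I K" "r \<in> R" for a r
    using that R_ideal_simps(4)[OF assms(1)] K by (simp add: colon_def R_sub m_assoc)
qed (auto simp: colon_def)

text \<open>Turns the condition on ideals into one on elements: the square of the principal ideal
  generated by r consists of multiples of \<open>r \<otimes> r\<close>.\<close>

lemma semiprime_square:
  assumes "semiprime_ideal I RR" "r \<in> R" "r \<otimes> r \<in> I"
  shows "r \<in> I"
proof -
  have I: "ideal I RR" using assms(1) by (simp add: semiprime_ideal_def)
  let ?J = "{s \<otimes> r | s. s \<in> R}"
  have J: "ideal ?J RR"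
  proof (rule R_idealI)
    show "\<zero> \<in> ?J" using assms(2) by (auto simp: R_sub intro!: exI[of _ \<zero>])
    show "a \<oplus> b \<in> ?J" if ab: "a \<in> ?J" "b \<in> ?J" for a b
    proof -
      obtain s t where "s \<in> R" "t \<in> R" "a = s \<otimes> r" "b = t \<otimes> r" using ab by blast
      then have "a \<oplus> b = (s \<oplus> t) \<otimes> r" "s \<oplus> t \<in> R" using assms(2) by (simp_all add: l_distr R_sub)
      then show ?thesis by blast
    qed
    show "u \<otimes> a \<in> ?J" if au: "a \<in> ?J" "u \<in> R" for a u
    proof -
      obtain s where "s \<in> R" "a = s \<otimes> r" using au by blast
      then have "u \<otimes> a = (u \<otimes> s) \<otimes> r" "u \<otimes> s \<in> R" using assms(2) au by (simp_all add: m_assoc R_sub)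
      then show ?thesis by blast
    qed
  qed (use assms(2) in auto)
  have "?J \<cdot>\<^bsub>RR\<^esub> ?J \<subseteq> I"
  proof
    fix a assume "a \<in> ?J \<cdot>\<^bsub>RR\<^esub> ?J"
    then show "a \<in> I"
    proof (induction rule: ideal_prod.induct)
      case (prod i j)
      then obtain s t where st: "s \<in> R" "t \<in> R" "i = s \<otimes> r" "j = t \<otimes> r" by blast
      have "i \<otimes> j = s \<otimes> t \<otimes> (r \<otimes> r)"
        using st assms(2) R_comm[of r t] by (simp add: m_assoc R_sub) (metis R_sub m_assoc)
      then show ?case using R_ideal_simps(4)[OF I assms(3)] st by simp
    next
      case (sum s1 s2)
      then show ?case using R_ideal_simps(3)[OF I] by simp
    qed
  qed
  then have "?J \<subseteq> I" using assms(1) J unfolding semiprime_ideal_def by blast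
  moreover have "r \<in> ?J" using assms(2) by (auto simp: R_sub intro!: exI[of _ \<one>])
  ultimately show ?thesis by blast
qed

text \<open>The preimages of K under the powers of \<open>\<sigma> i\<close> ascend and so become
  stationary at some m. An element k of K is the image of some s under the power Suc m; then s lies
  already in the preimage for m, and the m-th iterate of s is an element of K mapped to k.\<close>

lemma sigma_image_eq:
  assumes "noetherian_ring RR" "i < n" "ideal K RR" "\<sigma> i ` K \<subseteq> K"
  shows "\<sigma> i ` K = K"
proof
  interpret N: noetherian_ring RR by fact
  note K = R_ideal_simps[OF assms(3)]
  define C where "C m = {r \<in> R. (\<sigma> i ^^ m) r \<in> K}" for m
  have iter: "(\<sigma> i ^^ m) r \<in> R" if "r \<in> R" for m r
    using that assms(2) by (induction m) auto
  have hom: "(\<sigma> i ^^ m) (r \<oplus> s) = (\<sigma> i ^^ m) r \<oplus> (\<sigma> i ^^ m) s \<and>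
      (\<sigma> i ^^ m) (r \<otimes> s) = (\<sigma> i ^^ m) r \<otimes> (\<sigma> i ^^ m) s \<and> (\<sigma> i ^^ m) \<zero> = \<zero>"
    if "r \<in> R" "s \<in> R" for m r s
    using that assms(2) by (induction m) (auto simp: iter)
  have "(\<sigma> i ^^ m) \<zero> = \<zero>" for m using hom[of \<zero> \<zero>] by simp
  then have "ideal (C m) RR" for m
    by (intro R_idealI) (auto simp: C_def hom iter K(2-4))
  then have ideals: "range C \<subseteq> {I. ideal I RR}" by blast
  have "C m \<subseteq> C (Suc m)" for m
    using assms(4) by (auto simp: C_def)
  then have "C m \<subseteq> C k" if "m \<le> k" for m k
    using that by (rule lift_Suc_mono_le)
  then have "C m \<subseteq> C k \<or> C k \<subseteq> C m" for m k
    by (meson linorder_le_cases)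
  then have "subset.chain {I. ideal I RR} (range C)"
    using ideals by (simp add: subset_chain_def)
  \<comment> \<open>A nonempty chain of ideals in a Noetherian ring contains its union.\<close>
  then obtain m where m: "\<Union> (range C) = C m"
    using N.ideal_chain_is_trivial[of "range C"] by auto
  have onto: "\<exists>s\<in>R. (\<sigma> i ^^ m) s = r" if "r \<in> R" for m r
    using that
  proof (induction m arbitrary: r)
    case (Suc m)
    from Suc.prems obtain t where "t \<in> R" "\<sigma> i t = r"
      using sigma_bij[OF assms(2)] unfolding bij_betw_def by (metis imageE)
    then show ?case using Suc.IH[of t] by auto
  qed simp
  show "K \<subseteq> \<sigma> i ` K"
  proof
    fix k assume k: "k \<in> K"
    then obtain s where s: "s \<in> R" "(\<sigma> i ^^ Suc m) s = k" using onto[of k "Suc m"] K(1) by blast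
    then have "s \<in> C (Suc m)" using k by (simp add: C_def)
    then have "s \<in> C m" using m by blast
    then have "(\<sigma> i ^^ m) s \<in> K" by (simp add: C_def)
    then show "k \<in> \<sigma> i ` K" using s(2) by auto
  qed
qed (use assms in simp)

lemma foldr_sigma_image_eq:
  assumes "\<And>i. i < n \<Longrightarrow> \<sigma> i ` K = K" "set w \<subseteq> {..<n}"
  shows "foldr \<sigma> w ` K = K"
  using assms(2)
proof (induction w)
  case (Cons i w)
  have "foldr \<sigma> (i # w) ` K = \<sigma> i ` foldr \<sigma> w ` K" by (simp add: image_image)
  then show ?case using Cons assms(1) by simp
qed simp

end

context skew_PBW_invariant_ideal
begin

text \<open>The equality, rather than an inclusion, is used to write an arbitrary element of K as
  \<open>\<sigma> i k'\<close> with k' in K.\<close>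

lemma colon_stable:
  assumes "ideal K RR" "i < n" "\<sigma> i ` K = K"
  shows "\<sigma> i ` colon I K \<subseteq> colon I K"
proof
  fix s assume "s \<in> \<sigma> i ` colon I K"
  then obtain r where r: "s = \<sigma> i r" "r \<in> R" "\<forall>k\<in>K. r \<otimes> k \<in> I" by (auto simp: colon_def)
  have "\<sigma> i r \<otimes> k \<in> I" if k: "k \<in> K" for k
  proof -
    obtain k' where k': "k' \<in> K" "k = \<sigma> i k'" using assms(3) k by blast
    then have "\<sigma> i (r \<otimes> k') \<in> I" using r(3) assms(2) by simp
    then show ?thesis using k' r(2) assms(2) R_ideal_simps(1)[OF assms(1)] by auto
  qed
  then show "s \<in> colon I K" using r assms(2) by (simp add: colon_def)
qed

text \<open>For \<open>r k \<in> I\<close> the Leibniz rule gives \<open>\<delta> r k\<^sup>2 \<in> I\<close>, because \<open>\<sigma> r k \<in> I\<close>; semiprimeness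
  removes the square.\<close>

lemma colon_invariant:
  assumes "semiprime_ideal I RR" "ideal K RR" "\<And>i. i < n \<Longrightarrow> \<sigma> i ` K = K"
  shows "invariant_ideal RR n \<sigma> \<delta> (colon I K)"
proof -
  note K = R_ideal_simps[OF assms(2)]
  have "\<delta> i r \<in> colon I K" if i: "i < n" and r: "r \<in> colon I K" for i r
  proof -
    have rR: "r \<in> R" using r by (simp add: colon_def)
    have "\<delta> i r \<otimes> k \<in> I" if k: "k \<in> K" for k
    proof -
      have kR: "k \<in> R" using k K(1) by blast
      note [simp] = i rR kR R_sub
      have "r \<otimes> k \<in> I" using r k by (simp add: colon_def)
      then have 1: "(\<sigma> i r \<otimes> \<delta> i k \<oplus> \<delta> i r \<otimes> k) \<otimes> k \<in> I" using I_stable(2)[OF i, of "r \<otimes> k"] by simp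
      have "\<sigma> i r \<in> colon I K" using colon_stable[OF assms(2) i assms(3)[OF i]] r by blast
      then have "\<sigma> i r \<otimes> k \<in> I" using k by (simp add: colon_def)
      then have 2: "\<ominus> (\<delta> i k \<otimes> (\<sigma> i r \<otimes> k)) \<in> I" by simp
      have "\<sigma> i r \<otimes> \<delta> i k \<otimes> k = \<delta> i k \<otimes> (\<sigma> i r \<otimes> k)"
        using R_comm[of "\<sigma> i r" "\<delta> i k"] by (simp add: m_assoc[symmetric])
      then have "\<delta> i r \<otimes> k \<otimes> k = (\<sigma> i r \<otimes> \<delta> i k \<oplus> \<delta> i r \<otimes> k) \<otimes> k \<oplus> \<ominus> (\<delta> i k \<otimes> (\<sigma> i r \<otimes> k))"
        by (simp add: l_distr a_comm a_assoc l_neg a_lcomm r_neg)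
      then have "\<delta> i r \<otimes> k \<otimes> k \<in> I" using I_simps(2)[OF 1 2] by simp
      then have "\<delta> i r \<otimes> (\<delta> i r \<otimes> k \<otimes> k) \<in> I" by simp
      moreover have "(\<delta> i r \<otimes> k) \<otimes> (\<delta> i r \<otimes> k) = \<delta> i r \<otimes> (\<delta> i r \<otimes> k \<otimes> k)"
        using R_comm[of k "\<delta> i r \<otimes> k"] by (simp add: m_assoc)
      ultimately show ?thesis using semiprime_square[OF assms(1), of "\<delta> i r \<otimes> k"] by simp
    qed
    then show ?thesis using i rR by (simp add: colon_def)
  qed
  then show ?thesis
    using colon_ideal[OF I_ideal K(1)] colon_stable[OF assms(2) _ assms(3)]
    unfolding invariant_ideal_def by blast
qed

section \<open>The elements with coefficients in \<open>I\<close> as a two-sided ideal, and its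
  product forms\<close>

lemma coefs_in_closed: "a \<in> coefs_in \<Longrightarrow> a \<in> carrier A"
  by (simp add: coefs_in_def)

lemma coefs_in_simps [simp]:
  "\<zero> \<in> coefs_in" "a \<in> coefs_in \<Longrightarrow> b \<in> coefs_in \<Longrightarrow> a \<oplus> b \<in> coefs_in"
  "a \<in> coefs_in \<Longrightarrow> \<ominus> a \<in> coefs_in"
  "r \<in> R \<Longrightarrow> a \<in> coefs_in \<Longrightarrow> r \<otimes> a \<in> coefs_in"
  "r \<in> I \<Longrightarrow> h \<in> carrier A \<Longrightarrow> r \<otimes> h \<in> coefs_in"
  by (auto simp: coefs_in_def coef_add coef_uminus coef_smult I_sub R_sub)

lemma coefs_in_coef: "a \<in> coefs_in \<Longrightarrow> \<alpha> \<in> MI \<Longrightarrow> coef a \<alpha> \<in> I"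
  by (simp add: coefs_in_def)

text \<open>Termwise, both \<open>\<sigma> i\<close> and \<open>\<delta> i\<close> keep the
  coefficient inside \<open>I\<close>.\<close>

lemma x_coefs_in:
  assumes "i < n" "a \<in> coefs_in" shows "x i \<otimes> a \<in> coefs_in"
proof -
  have "a \<in> {b \<in> carrier A. x i \<otimes> b \<in> coefs_in}"
  proof (rule in_closed_set_if_terms)
  qed (use assms coefs_in_coef[OF assms(2)] x_closed in \<open>auto simp: coefs_in_closed r_distr x_scalar_mult I_sub R_sub\<close>)
  then show ?thesis by simp
qed

lemma coefs_in_l_closed:
  assumes "a \<in> carrier A" "b \<in> coefs_in" shows "a \<otimes> b \<in> coefs_in"
proof -
  have m: "mono_x \<alpha> \<otimes> b \<in> coefs_in" if "\<alpha> \<in> MI" for \<alpha>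
    using that assms(2)
    by (induction rule: multi_index_induct)
      (simp_all add: mono_x_zero mono_x_bump m_assoc x_closed coefs_in_closed x_coefs_in)
  have "a \<in> {h \<in> carrier A. h \<otimes> b \<in> coefs_in}"
  proof (rule in_closed_set_if_terms)
  qed (use assms m in \<open>auto simp: coefs_in_closed l_distr m_assoc R_sub\<close>)
  then show ?thesis by simp
qed

lemma coefs_in_r_closed:
  assumes "a \<in> carrier A" "b \<in> coefs_in" shows "b \<otimes> a \<in> coefs_in"
proof -
  have "b \<in> {h \<in> carrier A. h \<otimes> a \<in> coefs_in}"
  proof (rule in_closed_set_if_terms)
  qed (use assms coefs_in_coef[OF assms(2)] in \<open>auto simp: coefs_in_closed l_distr m_assoc R_sub I_sub\<close>)
  then show ?thesis by simp
qed

lemma coefs_in_ideal: "ideal coefs_in A"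
proof (rule idealI)
  show "subgroup coefs_in (add_monoid A)"
    by (rule add.subgroupI) (auto simp: coefs_in_closed intro: coefs_in_simps(1))
qed (auto simp: ring_axioms coefs_in_l_closed coefs_in_r_closed)

lemma I_sub_coefs_in: "r \<in> I \<Longrightarrow> r \<in> coefs_in"
  using coefs_in_simps(5)[of r \<one>] by (simp add: I_sub R_sub)

lemma coefs_in_eq_prod: "coefs_in = I \<cdot>\<^bsub>A\<^esub> carrier A"
proof
  show "I \<cdot>\<^bsub>A\<^esub> carrier A \<subseteq> coefs_in"
  proof
    fix a assume "a \<in> I \<cdot>\<^bsub>A\<^esub> carrier A"
    then show "a \<in> coefs_in" by (induction rule: ideal_prod.induct) auto
  qed
  have sub: "I \<cdot>\<^bsub>A\<^esub> carrier A \<subseteq> carrier A"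
    using \<open>I \<cdot>\<^bsub>A\<^esub> carrier A \<subseteq> coefs_in\<close> coefs_in_closed by blast
  have "\<zero> \<in> I \<cdot>\<^bsub>A\<^esub> carrier A" using ideal_prod.prod[of \<zero> I \<zero> "carrier A" A] by simp
  then have "a \<in> I \<cdot>\<^bsub>A\<^esub> carrier A" if "a \<in> coefs_in" for a
    by (intro in_closed_set_if_terms[OF coefs_in_closed[OF that] sub] ideal_prod.intros
        coefs_in_coef[OF that]) auto
  then show "coefs_in \<subseteq> I \<cdot>\<^bsub>A\<^esub> carrier A" by blast
qed

lemma prod_sub_coefs_in: "carrier A \<cdot>\<^bsub>A\<^esub> I \<subseteq> coefs_in"
proof
  fix a assume "a \<in> carrier A \<cdot>\<^bsub>A\<^esub> I"
  then show "a \<in> coefs_in"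
    by (induction rule: ideal_prod.induct) (auto intro: coefs_in_l_closed I_sub_coefs_in)
qed

text \<open>Coefficients are moved to the right of the monomials one variable at a time: for r =
  \<open>\<sigma> i s\<close> one has r \<open>x i\<close> = \<open>x i\<close> s -
  \<open>\<delta> i s\<close>. Surjectivity of \<open>\<sigma> i\<close> on \<open>I\<close>
  supplies s in \<open>I\<close>, and invariance under \<open>\<delta> i\<close> keeps the
  correction in reach of the induction.\<close>

lemma coefs_in_sub_prod:
  assumes "\<And>i. i < n \<Longrightarrow> \<sigma> i ` I = I"
  shows "coefs_in \<subseteq> carrier A \<cdot>\<^bsub>A\<^esub> I"
proof
  let ?P = "carrier A \<cdot>\<^bsub>A\<^esub> I"
  have sub: "?P \<subseteq> carrier A" using prod_sub_coefs_in coefs_in_closed by blast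
  have left: "a \<otimes> b \<in> ?P" if "a \<in> carrier A" "b \<in> ?P" for a b
    using that(2)
  proof (induction rule: ideal_prod.induct)
    case (prod s r)
    then have "a \<otimes> (s \<otimes> r) = (a \<otimes> s) \<otimes> r" using that(1) by (simp add: m_assoc I_sub R_sub)
    then show ?case using prod that(1) by (auto intro: ideal_prod.prod)
  next
    case (sum s1 s2)
    then have "s1 \<in> carrier A" "s2 \<in> carrier A" using sub by auto
    then have "a \<otimes> (s1 \<oplus> s2) = a \<otimes> s1 \<oplus> a \<otimes> s2" using that(1) by (simp add: r_distr)
    then show ?case using sum by (auto intro: ideal_prod.sum)
  qed
  have terms: "\<forall>r\<in>I. r \<otimes> mono_x \<alpha> \<in> ?P" if "\<alpha> \<in> MI" for \<alpha>
    using that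
  proof (induction rule: multi_index_induct)
    case zero
    have "r \<in> ?P" if "r \<in> I" for r
      using ideal_prod.prod[of \<one> "carrier A" r I A] that by (simp add: I_sub R_sub)
    then show ?case by (simp add: mono_x_zero I_sub R_sub)
  next
    case (bump i \<beta>)
    show ?case
    proof
      fix r assume "r \<in> I"
      then obtain s where s: "s \<in> I" "r = \<sigma> i s" using assms[OF bump(1)] by blast
      note [simp] = bump(1) x_closed R_sub I_sub s(1)
      have "r \<otimes> mono_x (bump i \<beta>) = x i \<otimes> (s \<otimes> mono_x \<beta>) \<oplus> \<ominus> \<delta> i s \<otimes> mono_x \<beta>"
        unfolding s(2) using bump(3) by (simp add: mono_x_bump x_scalar_mult l_minus a_assoc r_neg)
      moreover have "s \<otimes> mono_x \<beta> \<in> ?P" "\<ominus> \<delta> i s \<otimes> mono_x \<beta> \<in> ?P" using bump(4) by auto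
      ultimately show "r \<otimes> mono_x (bump i \<beta>) \<in> ?P" by (metis ideal_prod.sum left x_closed bump(1))
    qed
  qed
  have "\<zero> \<in> ?P" using ideal_prod.prod[of \<zero> "carrier A" \<zero> I A] by simp
  then show "a \<in> ?P" if "a \<in> coefs_in" for a
    by (intro in_closed_set_if_terms[OF coefs_in_closed[OF that] sub] ideal_prod.sum)
      (use that terms coefs_in_coef in auto)
qed

section \<open>Contraction to \<open>R\<close> and transfer of primeness\<close>

lemma coefs_in_Int_R: "coefs_in \<inter> R = I"
proof
  show "coefs_in \<inter> R \<subseteq> I"
  proof
    fix r assume "r \<in> coefs_in \<inter> R"
    \<comment> \<open>The constant coefficient of an element of \<open>R\<close> is that element
      itself.\<close>
    then show "r \<in> I" using coefs_in_coef[of r "mi_zero n"] by (simp add: coef_scalar)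
  qed
qed (auto simp: I_sub_coefs_in I_sub)

text \<open>Invariant ideals J and K of \<open>R\<close> are extended to JA and KA. Since KA absorbs
  monomials from the left, the product (JA)(KA) has its coefficients in \<open>I\<close> once JK
  does; primeness of IA applies, and intersecting with \<open>R\<close> returns to J and K.\<close>

lemma invariant_prime_if_prime:
  assumes "prime_two_sided_ideal coefs_in A"
  shows "invariant_prime_ideal RR n \<sigma> \<delta> I"
  unfolding invariant_prime_ideal_def
proof (intro conjI allI impI)
  show "invariant_ideal RR n \<sigma> \<delta> I" by (rule I_invariant)
  show "I \<noteq> carrier RR"
  proof
    assume "I = carrier RR"
    then have "\<one> \<in> coefs_in" by (intro I_sub_coefs_in) simp
    then have "coefs_in = carrier A" using coefs_in_r_closed[of _ \<one>] coefs_in_closed by auto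
    then show False using assms by (simp add: prime_two_sided_ideal_def)
  qed
next
  fix J K
  assume J: "invariant_ideal RR n \<sigma> \<delta> J" and K: "invariant_ideal RR n \<sigma> \<delta> K" and JK: "J \<cdot>\<^bsub>RR\<^esub> K \<subseteq> I"
  \<comment> \<open>The same theory is instantiated at J and K, so that \<open>J.coefs_in\<close>
    and \<open>K.coefs_in\<close> stand for JA and KA.\<close>
  interpret J: skew_PBW_invariant_ideal A R n x \<sigma> \<delta> c J
    by unfold_locales (rule J)
  interpret K: skew_PBW_invariant_ideal A R n x \<sigma> \<delta> c K
    by unfold_locales (rule K)
  have jk: "j \<otimes> k \<in> I" if "j \<in> J" "k \<in> K" for j k
    using ideal_prod.prod[of j J k K RR] that JK by auto
  have jb: "j \<otimes> b \<in> coefs_in" if "j \<in> J" "b \<in> K.coefs_in" for j b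
    unfolding coefs_in_def using that K.coefs_in_closed K.coefs_in_coef
    by (auto simp: coef_smult J.I_sub R_sub intro: jk)
  have ab: "a \<otimes> b \<in> coefs_in" if "a \<in> J.coefs_in" "b \<in> K.coefs_in" for a b
  proof -
    have "a \<in> {h \<in> carrier A. h \<otimes> b \<in> coefs_in}"
    proof (rule in_closed_set_if_terms)
    qed (use that K.coefs_in_l_closed[OF _ that(2)] J.coefs_in_coef in \<open>auto simp: J.coefs_in_closed
      K.coefs_in_closed l_distr m_assoc R_sub J.I_sub jb\<close>)
    then show ?thesis by simp
  qed
  have "u \<in> coefs_in" if "u \<in> J.coefs_in \<cdot>\<^bsub>A\<^esub> K.coefs_in" for u
    using that by (induction rule: ideal_prod.induct) (auto intro: ab)
  then have "J.coefs_in \<subseteq> coefs_in \<or> K.coefs_in \<subseteq> coefs_in"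
    using assms J.coefs_in_ideal K.coefs_in_ideal unfolding prime_two_sided_ideal_def by blast
  then show "J \<subseteq> I \<or> K \<subseteq> I"
    using J.coefs_in_Int_R K.coefs_in_Int_R coefs_in_Int_R by blast
qed

text \<open>Words in the variables suffice as middle factors between f and g. This is where leading
  coefficients meet the colon ideals.\<close>

lemma word_product_notin_coefs_in:
  assumes prime: "invariant_prime_ideal RR n \<sigma> \<delta> I" and semiprime: "semiprime_ideal I RR"
    and noetherian: "noetherian_ring RR"
    and fg: "f \<in> carrier A" "g \<in> carrier A" "f \<notin> coefs_in" "g \<notin> coefs_in"
  shows "\<exists>w. set w \<subseteq> {..<n} \<and> f \<otimes> foldr (\<lambda>i h. x i \<otimes> h) w g \<notin> coefs_in"
proof (rule ccontr)
  assume "\<not> ?thesis"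
  then have zero: "\<And>w. set w \<subseteq> {..<n} \<Longrightarrow> f \<otimes> foldr (\<lambda>i h. x i \<otimes> h) w g \<in> coefs_in" by blast
  obtain \<zeta> a where a: "\<zeta> \<in> MI" "a \<in> R" "a \<notin> I" "lead \<zeta> f a" using lead_exists[OF fg(1,3)] .
  obtain \<eta> b where b: "\<eta> \<in> MI" "b \<in> R" "b \<notin> I" "lead \<eta> g b" using lead_exists[OF fg(2,4)] .
  obtain w0 where w0: "set w0 \<subseteq> {..<n}" "\<And>f a \<eta> g b. lead \<zeta> f a \<Longrightarrow> \<eta> \<in> MI \<Longrightarrow> lead \<eta> g b \<Longrightarrow>
       \<exists>v\<in>Units RR. lead (mi_add n \<zeta> \<eta>) (f \<otimes> g) (a \<otimes> (foldr \<sigma> w0 b \<otimes> v))"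
    using lead_mult[OF a(1)] by blast
  \<comment> \<open>The fixed word \<open>w0\<close> accounts for the leading exponent of f.
    Quantifying over all words w makes K stable under every \<open>\<sigma> i\<close>.\<close>
  define K where "K = {s \<in> R. \<forall>w. set w \<subseteq> {..<n} \<longrightarrow> a \<otimes> foldr \<sigma> w0 (foldr \<sigma> w s) \<in> I}"
  have "b \<in> K"
  proof -
    have "a \<otimes> foldr \<sigma> w0 (foldr \<sigma> w b) \<in> I" if w: "set w \<subseteq> {..<n}" for w
    proof -
      note [simp] = w w0(1) a(2) b(2) R_Units_closed
      let ?g = "foldr (\<lambda>i h. x i \<otimes> h) w g"
      obtain \<theta> v where v: "\<theta> \<in> MI" "v \<in> Units RR" "lead \<theta> ?g (foldr \<sigma> w b \<otimes> v)"
        using lead_word[OF w b(1,4)] by blast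
      obtain v' where v': "v' \<in> Units RR"
        "lead (mi_add n \<zeta> \<theta>) (f \<otimes> ?g) (a \<otimes> (foldr \<sigma> w0 (foldr \<sigma> w b \<otimes> v) \<otimes> v'))"
        using w0(2)[OF a(4) v(1,3)] by blast
      have "a \<otimes> (foldr \<sigma> w0 (foldr \<sigma> w b \<otimes> v) \<otimes> v') \<in> I"
        using lead_coef_in_I[OF v'(2) mi_add_closed zero[OF w]] .
      moreover have "a \<otimes> (foldr \<sigma> w0 (foldr \<sigma> w b \<otimes> v) \<otimes> v') =
          a \<otimes> foldr \<sigma> w0 (foldr \<sigma> w b) \<otimes> (foldr \<sigma> w0 v \<otimes> v')"
        using v(2) v'(1) by (simp add: m_assoc R_sub)
      \<comment> \<open>The trailing factor \<open>foldr \<sigma> w0 v \<otimes> v'\<close> is a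
        unit of \<open>R\<close> and can be cancelled modulo \<open>I\<close>.\<close>
      ultimately show ?thesis
        using Units_cancel_ideal[OF I_ideal _ R_Units_mult[OF foldr_sigma_Units[OF w0(1) v(2)] v'(1)]]
        by simp
    qed
    then show ?thesis using b(2) by (simp add: K_def)
  qed
  have K: "ideal K RR"
  proof (rule R_idealI)
    fix s r assume s: "s \<in> K" and r: "r \<in> R"
    have "a \<otimes> foldr \<sigma> w0 (foldr \<sigma> w (r \<otimes> s)) \<in> I" if w: "set w \<subseteq> {..<n}" for w
    proof -
      let ?r = "foldr \<sigma> w0 (foldr \<sigma> w r)" and ?s = "foldr \<sigma> w0 (foldr \<sigma> w s)"
      have rs: "?r \<in> R" "?s \<in> R" "s \<in> R" "a \<otimes> ?s \<in> I"
        using s r w w0(1) by (auto simp: K_def)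
      then have "a \<otimes> (?r \<otimes> ?s) = ?r \<otimes> (a \<otimes> ?s)"
        using a(2) R_comm[of a ?r] by (simp add: m_assoc[symmetric] R_sub)
      then show ?thesis using r w w0(1) rs by simp
    qed
    then show "r \<otimes> s \<in> K" using r s by (simp add: K_def)
  qed (use a(2) w0(1) in \<open>auto simp: K_def R_sub r_distr\<close>)
  have K_stable: "\<sigma> i ` K \<subseteq> K" if i: "i < n" for i
  proof -
    have "a \<otimes> foldr \<sigma> w0 (foldr \<sigma> w (\<sigma> i s)) \<in> I" if "s \<in> K" "set w \<subseteq> {..<n}" for s w
      \<comment> \<open>Applying \<open>\<sigma> i\<close> first amounts to appending i to the
        word.\<close>
      using that i by (auto simp: K_def dest!: spec[of _ "w @ [i]"])
    then show ?thesis using i by (auto simp: K_def)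
  qed
  have K_eq: "\<sigma> i ` K = K" if "i < n" for i
    using sigma_image_eq[OF noetherian that K K_stable[OF that]] .
  let ?L = "colon I K"
  have L: "invariant_ideal RR n \<sigma> \<delta> ?L" using colon_invariant[OF semiprime K K_eq] .
  then have L': "ideal ?L RR" "\<And>i. i < n \<Longrightarrow> \<sigma> i ` ?L \<subseteq> ?L" by (auto simp: invariant_ideal_def)
  \<comment> \<open>Being invariant, \<open>?L\<close> is mapped onto itself by each
    \<open>\<sigma> i\<close>, so the colon construction can be repeated with \<open>?L\<close> in
    place of K.\<close>
  have LL: "invariant_ideal RR n \<sigma> \<delta> (colon I ?L)"
    using colon_invariant[OF semiprime L'(1) sigma_image_eq[OF noetherian _ L'(1) L'(2)]] .
  have "u \<in> I" if "u \<in> colon I ?L \<cdot>\<^bsub>RR\<^esub> ?L" for u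
    using that by (induction rule: ideal_prod.induct) (auto simp: colon_def)
  then have "colon I ?L \<subseteq> I \<or> ?L \<subseteq> I"
    using prime L LL unfolding invariant_prime_ideal_def by blast
  moreover have "a \<in> ?L"
  proof -
    have "a \<otimes> k \<in> I" if k: "k \<in> K" for k
    proof -
      \<comment> \<open>Since \<open>foldr \<sigma> w0\<close> maps K onto itself, k comes from some
        s in K; the empty word in the definition of K then gives a k \<in> \<open>I\<close>.\<close>
      obtain s where "s \<in> K" "k = foldr \<sigma> w0 s" using foldr_sigma_image_eq[OF K_eq w0(1)] k by blast
      then show ?thesis by (auto simp: K_def dest: spec[of _ "[]"])
    qed
    then show ?thesis using a(2) by (simp add: colon_def)
  qed
  \<comment> \<open>Every element of \<open>?L\<close> multiplies the element b of K into
    \<open>I\<close>; commutativity exchanges the factors.\<close>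
  moreover have "b \<in> colon I ?L"
    using \<open>b \<in> K\<close> b(2) R_comm by (auto simp: colon_def)
  ultimately show False using a(3) b(3) by blast
qed

text \<open>Elements f of J and g of K outside IA give a word w with f (w g) outside IA, although w
  g is in K because K is a left ideal, so that f (w g) lies in JK.\<close>

lemma prime_if_invariant_prime:
  assumes "invariant_prime_ideal RR n \<sigma> \<delta> I" "semiprime_ideal I RR" "noetherian_ring RR"
  shows "prime_two_sided_ideal coefs_in A"
  unfolding prime_two_sided_ideal_def
proof (intro conjI allI impI)
  show "ideal coefs_in A" by (rule coefs_in_ideal)
  \<comment> \<open>If IA were all of A, intersecting with \<open>R\<close> would give
    \<open>I\<close> = \<open>R\<close>.\<close>
  show "coefs_in \<noteq> carrier A"
    using coefs_in_Int_R assms(1) subringE(1)[OF subring_R]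
    by (auto simp: invariant_prime_ideal_def)
  fix J K assume J: "ideal J A" and K: "ideal K A" and JK: "J \<cdot>\<^bsub>A\<^esub> K \<subseteq> coefs_in"
  show "J \<subseteq> coefs_in \<or> K \<subseteq> coefs_in"
  proof (rule ccontr)
    assume "\<not> ?thesis"
    then obtain f g where fg: "f \<in> J" "g \<in> K" "f \<notin> coefs_in" "g \<notin> coefs_in" by blast
    have "f \<in> carrier A" "g \<in> carrier A"
      using fg ideal.Icarr[OF J] ideal.Icarr[OF K] by auto
    then obtain w where w: "set w \<subseteq> {..<n}" "f \<otimes> foldr (\<lambda>i h. x i \<otimes> h) w g \<notin> coefs_in"
      using word_product_notin_coefs_in[OF assms] fg(3,4) by blast
    have "foldr (\<lambda>i h. x i \<otimes> h) w g \<in> K"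
      using w(1) by (induction w) (auto simp: fg(2) ideal.I_l_closed[OF K] x_closed)
    then show False using ideal_prod.prod[of f J _ K A] fg(1) w(2) JK by blast
  qed
qed

end

theorem theorem5p7:
  fixes A :: "('a, 'm) ring_scheme" and R I :: "'a set" and n :: nat and x :: "nat \<Rightarrow> 'a"
    and \<sigma> \<delta> :: "nat \<Rightarrow> 'a \<Rightarrow> 'a" and c :: "nat \<Rightarrow> nat \<Rightarrow> 'a"
  assumes "bijective_skew_PBW_system A R n x \<sigma> \<delta> c"
    and "cring (A\<lparr>carrier := R\<rparr>)"
    and "noetherian_ring (A\<lparr>carrier := R\<rparr>)"
    and "semiprime_ring (A\<lparr>carrier := R\<rparr>)"
    and "semiprime_ideal I (A\<lparr>carrier := R\<rparr>)"
    and "invariant_ideal (A\<lparr>carrier := R\<rparr>) n \<sigma> \<delta> I"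
  shows "(invariant_prime_ideal (A\<lparr>carrier := R\<rparr>) n \<sigma> \<delta> I \<longleftrightarrow>
            prime_two_sided_ideal (I \<cdot>\<^bsub>A\<^esub> carrier A) A) \<and>
         (invariant_prime_ideal (A\<lparr>carrier := R\<rparr>) n \<sigma> \<delta> I \<longrightarrow>
            I \<cdot>\<^bsub>A\<^esub> carrier A = carrier A \<cdot>\<^bsub>A\<^esub> I \<and> I = (I \<cdot>\<^bsub>A\<^esub> carrier A) \<inter> R)"
proof -
  interpret bijective_skew_PBW_system A R n x \<sigma> \<delta> c by fact
  interpret skew_PBW_invariant_ideal A R n x \<sigma> \<delta> c I
    by (intro skew_PBW_invariant_ideal.intro commutative_skew_PBW.intro
        commutative_skew_PBW_axioms.intro skew_PBW_invariant_ideal_axioms.intro assms)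
  \<comment> \<open>The Noetherian condition upgrades stability of \<open>I\<close> to equality,
    which allows coefficients to be moved to the right and yields IA = AI.\<close>
  have "\<sigma> i ` I = I" if "i < n" for i
    using sigma_image_eq[OF assms(3) that I_ideal] I_stable(1)[OF that] by blast
  then have "coefs_in = carrier A \<cdot>\<^bsub>A\<^esub> I"
    using coefs_in_sub_prod prod_sub_coefs_in by blast
  then show ?thesis
    using prime_if_invariant_prime[OF _ assms(5,3)] invariant_prime_if_prime coefs_in_Int_R
    by (auto simp: coefs_in_eq_prod[symmetric])
qed

end
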